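(* Let $\lambda$ and $\alpha$ be real numbers with $|\lambda|<\pi\alpha/2<\pi/2$. The function $$g(z)=z\exp\int_1^z\left[\left(\frac{1+\zeta e^{2i\lambda/\alpha}}{1-\zeta}\right)^\alpha-1\right]\frac{d\zeta}{\zeta}$$ maps $\mathbb{D}$ conformally onto $U_{\lambda,\alpha}$ in such a way that $g(0)=0$ and $g(1)=1$.
   Context: $\mathbb{D}=\{z\in\mathbb{C}:|z|<1\}$. The power $\left(\frac{1+\zeta e^{2i\lambda/\alpha}}{1-\zeta}\right)^\alpha$ is the analytic branch on $\mathbb{D}$ taking the value $1$ at $\zeta=0$ (so the integrand is analytic on $\mathbb{D}$, with a removable singularity at $0$); the integral is taken along a path in $\mathbb{D}$ from the boundary point $1$ to $z$ (e.g. a line segment), where the singularity at $\zeta=1$ is integrable. The value $g(1)=1$ is understood for the continuous boundary extension of $g$. For $r>0$, $\theta\in\mathbb{R}$ put $P_\lambda(r,\theta)=re^{i(\theta+\tan\lambda\cdot\log r)}=\exp[(1+i\tan\lambda)\log r+i\theta]$, and $P_\lambda(0,\theta)=0$. With $$A=\cos^2\lambda\left(\tan\tfrac{\pi\alpha}{2}-\tan\lambda\right)>0,\qquad B=-\cos^2\lambda\left(\tan\tfrac{\pi\alpha}{2}+\tan\lambda\right)<0,$$ the standard strongly $\lambda$-spirallike domain of order $\alpha$ is $$U_{\lambda,\alpha}=\{P_\lambda(r,\theta):0\le\theta<2\pi,\ 0\le r<\max\{e^{B\theta},e^{-A(2\pi-\theta)}\}\}.$$ *)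

theory Defs
  imports "HOL-Complex_Analysis.Complex_Analysis"
begin

(* The principal branch of the complex power. The quotient maps the unit disc
   into the plane slit along the nonpositive reals, so this is the analytic branch with value 1
   at 0: see spiral_power_base, spiral_power_holomorphic and spiral_power_0 below. *)
definition spiral_power :: "real \<Rightarrow> real \<Rightarrow> complex \<Rightarrow> complex" where
  "spiral_power lam \<alpha> \<zeta> =
     ((1 + \<zeta> * exp (2 * \<i> * of_real lam / of_real \<alpha>)) / (1 - \<zeta>)) powr of_real \<alpha>"

(* The integral runs along the segment from the boundary point 1 to z. The values at \<zeta> = 1
   (integrable singularity) and \<zeta> = 0 (removable singularity) do not influence it. *)
definition spiral_map :: "real \<Rightarrow> real \<Rightarrow> complex \<Rightarrow> complex" where
  "spiral_map lam \<alpha> z =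
     z * exp (contour_integral (linepath 1 z) (\<lambda>\<zeta>. (spiral_power lam \<alpha> \<zeta> - 1) / \<zeta>))"

definition spiral_polar :: "real \<Rightarrow> real \<Rightarrow> real \<Rightarrow> complex" where
  "spiral_polar lam r \<theta> =
     (if r = 0 then 0
      else exp ((1 + \<i> * of_real (tan lam)) * of_real (ln r) + \<i> * of_real \<theta>))"

definition spiral_A :: "real \<Rightarrow> real \<Rightarrow> real" where
  "spiral_A lam \<alpha> = (cos lam)\<^sup>2 * (tan (pi * \<alpha> / 2) - tan lam)"

definition spiral_B :: "real \<Rightarrow> real \<Rightarrow> real" where
  "spiral_B lam \<alpha> = - (cos lam)\<^sup>2 * (tan (pi * \<alpha> / 2) + tan lam)"

definition spirallike_domain :: "real \<Rightarrow> real \<Rightarrow> complex set" where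
  "spirallike_domain lam \<alpha> =
     {spiral_polar lam r \<theta> | r \<theta>. 0 \<le> \<theta> \<and> \<theta> < 2 * pi \<and> 0 \<le> r \<and>
        r < max (exp (spiral_B lam \<alpha> * \<theta>)) (exp (- spiral_A lam \<alpha> * (2 * pi - \<theta>)))}"

definition maps_conformally_onto ::
    "(complex \<Rightarrow> complex) \<Rightarrow> complex set \<Rightarrow> complex set \<Rightarrow> bool" where
  "maps_conformally_onto f S T \<longleftrightarrow> f holomorphic_on S \<and> bij_betw f S T"

lemma spiral_power_base:
  assumes \<zeta>: "norm \<zeta> < 1"
  shows "(1 + \<zeta> * exp (2 * \<i> * of_real lam / of_real \<alpha>)) / (1 - \<zeta>) \<notin> \<real>\<^sub>\<le>\<^sub>0"
proof
  define c where "c = exp (2 * \<i> * complex_of_real lam / complex_of_real \<alpha>)"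
  assume "(1 + \<zeta> * exp (2 * \<i> * of_real lam / of_real \<alpha>)) / (1 - \<zeta>) \<in> \<real>\<^sub>\<le>\<^sub>0"
  then obtain x :: real where x: "x \<le> 0" "(1 + \<zeta> * c) / (1 - \<zeta>) = of_real x"
    unfolding c_def by (metis complex_nonpos_Reals_iff complex_is_Real_iff of_real_Re)
  have "1 - \<zeta> \<noteq> 0" using \<zeta> by auto
  with x have eq: "of_real (1 - x) = - \<zeta> * (c + of_real x)"
    by (simp add: field_simps)
  have "c = cis (2 * lam / \<alpha>)" by (simp add: c_def cis_conv_exp mult_ac)
  then have "norm (c + of_real x) \<le> 1 - x"
    using norm_triangle_ineq[of c "of_real x"] x(1) by simp
  moreover have "1 - x = norm \<zeta> * norm (c + of_real x)"
    using arg_cong[OF eq, of norm] x(1) by (simp add: norm_mult del: of_real_diff)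
  moreover have "norm \<zeta> * norm (c + of_real x) \<le> norm \<zeta> * (1 - x)"
    using calculation(1) by (intro mult_left_mono) auto
  ultimately have "1 - x \<le> norm \<zeta> * (1 - x)" by simp
  with \<zeta> x(1) show False by (simp add: mult_le_cancel_right2)
qed

lemma spiral_power_holomorphic: "spiral_power lam \<alpha> holomorphic_on ball 0 1"
  unfolding spiral_power_def using spiral_power_base
  by (intro holomorphic_intros) auto

lemma spiral_power_0: "spiral_power lam \<alpha> 0 = 1"
  by (simp add: spiral_power_def)

lemma spiral_integrand_integrable:
  assumes lam: "\<bar>lam\<bar> < pi * \<alpha> / 2" and al: "pi * \<alpha> / 2 < pi / 2" and z: "z \<in> ball 0 1"
  shows "(\<lambda>\<zeta>. (spiral_power lam \<alpha> \<zeta> - 1) / \<zeta>) contour_integrable_on linepath 1 z"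
proof -
  define p where "p = spiral_power lam \<alpha>"
  define F where "F = (\<lambda>\<zeta>. if \<zeta> = 0 then deriv p 0 else (p \<zeta> - p 0) / (\<zeta> - 0))"
  define d where "d = norm (1 - z)"
  have p0: "p 0 = 1" by (simp add: p_def spiral_power_0)
  have "0 < pi * \<alpha>" using lam abs_ge_zero[of lam] by linarith
  then have a: "0 < \<alpha>" "\<alpha> < 1" using al by (auto simp: zero_less_mult_iff)
  have zn: "norm z < 1" using z by simp
  then have d: "0 < d" "d < 2"
    using norm_triangle_ineq4[of 1 z] by (auto simp: d_def)
  have "F holomorphic_on ball 0 1"
    unfolding F_def using spiral_power_holomorphic p_def by (intro pole_lemma_open) auto
  then have contF: "continuous_on (ball 0 1) F"
    by (rule holomorphic_on_imp_continuous_on)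
  have inball: "linepath 1 z t \<in> ball 0 1" if "t \<in> {0<..1}" for t
  proof -
    have "norm (linepath 1 z t) \<le> norm ((1 - t) *\<^sub>R (1::complex)) + norm (t *\<^sub>R z)"
      unfolding linepath_def by (rule norm_triangle_ineq)
    also have "\<dots> = (1 - t) + t * norm z" using that by (simp del: scaleR_conv_of_real)
    also have "\<dots> < 1" using that zn by (simp add: algebra_simps)
    finally show ?thesis by simp
  qed
  define h where "h = (\<lambda>t. F (linepath 1 z t) * (z - 1))"
  have conth: "continuous_on {0<..1} h"
    unfolding h_def using inball
    by (intro continuous_intros continuous_on_compose2[OF contF] continuous_on_linepath) auto
  have "continuous_on {1/4..1} h" by (rule continuous_on_subset[OF conth]) auto
  then have "bounded (h ` {1/4..1})"
    by (intro compact_imp_bounded compact_continuous_image) auto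
  then obtain M where M: "\<And>t. t \<in> {1/4..1} \<Longrightarrow> norm (h t) \<le> M" and "M > 0"
    unfolding bounded_pos by blast
  define K where "K = 2 * ((2 / d) powr \<alpha> + 1) * d"
  have K: "norm (h t) \<le> K * t powr - \<alpha>" if t: "t \<in> {0<..<1/4}" for t
  proof -
    define \<zeta> where "\<zeta> = linepath 1 z t"
    have 1: "1 - \<zeta> = t *\<^sub>R (1 - z)" by (simp add: \<zeta>_def linepath_def algebra_simps scaleR_conv_of_real)
    then have n1: "norm (1 - \<zeta>) = t * d" using t by (simp add: d_def)
    have "t * d \<le> 1/4 * 2" using t d by (intro mult_mono) auto
    then have half: "norm \<zeta> \<ge> 1/2"
      using n1 norm_triangle_ineq2[of 1 "1 - \<zeta>"] by simp
    have ball: "norm \<zeta> < 1" using inball[of t] t by (simp add: \<zeta>_def)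
    define c where "c = exp (2 * \<i> * complex_of_real lam / complex_of_real \<alpha>)"
    have "c = cis (2 * lam / \<alpha>)" by (simp add: c_def cis_conv_exp mult_ac)
    then have "norm (1 + \<zeta> * c) \<le> 2"
      using ball norm_triangle_ineq[of 1 "\<zeta> * c"] by (simp add: norm_mult)
    then have "norm ((1 + \<zeta> * c) / (1 - \<zeta>)) \<le> 2 / (t * d)"
      using n1 t d by (simp add: norm_divide divide_right_mono)
    then have "norm (p \<zeta>) \<le> (2 / (t * d)) powr \<alpha>"
      using a unfolding p_def spiral_power_def c_def[symmetric]
      by (simp add: norm_powr_real_powr' powr_mono2)
    also have "\<dots> = (2 / d) powr \<alpha> * t powr - \<alpha>"
      using t d by (simp add: powr_divide powr_mult powr_minus field_simps)
    finally have np: "norm (p \<zeta>) \<le> (2 / d) powr \<alpha> * t powr - \<alpha>" .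
    have "1 = 1 powr - \<alpha>" by simp
    also have "\<dots> \<le> t powr - \<alpha>" using t a by (intro powr_mono2') auto
    finally have "norm (p \<zeta> - 1) \<le> ((2 / d) powr \<alpha> + 1) * t powr - \<alpha>"
      using np norm_triangle_ineq4[of "p \<zeta>" 1] by (simp add: algebra_simps)
    then have "norm (p \<zeta> - 1) / norm \<zeta> \<le> (((2 / d) powr \<alpha> + 1) * t powr - \<alpha>) / (1/2)"
      using half by (intro frac_le) auto
    moreover have "norm (h t) = norm (p \<zeta> - 1) / norm \<zeta> * d"
      using half p0 by (auto simp: h_def F_def \<zeta>_def[symmetric] norm_mult norm_divide d_def norm_minus_commute)
    ultimately have "norm (h t) \<le> (((2 / d) powr \<alpha> + 1) * t powr - \<alpha>) / (1/2) * d"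
      using d by (simp only: mult_right_mono less_imp_le)
    then show ?thesis by (simp add: K_def algebra_simps)
  qed
  have bound: "norm (h t) \<le> (K + M) * t powr - \<alpha>" if t: "t \<in> {0<..1}" for t
  proof (cases "t < 1/4")
    case True
    then show ?thesis using K[of t] t \<open>M > 0\<close>
      by (smt (verit, best) greaterThanAtMost_iff greaterThanLessThan_iff mult_right_mono powr_ge_zero)
  next
    case False
    have "1 = 1 powr - \<alpha>" by simp
    also have "\<dots> \<le> t powr - \<alpha>" using t a by (intro powr_mono2') auto
    finally have "M * 1 \<le> (K + M) * t powr - \<alpha>"
      using \<open>M > 0\<close> d by (intro mult_mono) (auto simp: K_def)
    then show ?thesis using M[of t] False t by simp
  qed
  have "h integrable_on {0<..1}"
  proof (rule measurable_bounded_by_integrable_imp_integrable)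
    show "h \<in> borel_measurable (lebesgue_on {0<..1})"
      by (rule continuous_imp_measurable_on_sets_lebesgue[OF conth]) auto
    show "(\<lambda>t. (K + M) * t powr - \<alpha>) integrable_on {0<..1}"
      using integrable_on_cmult_left[OF integrable_on_powr_from_0'[of "-\<alpha>" 1], of "K + M"] a by simp
  qed (use bound in auto)
  then have "h integrable_on {0..1}"
    by (rule integrable_spike_set) (auto intro: negligible_subset[of "{0}"])
  then have "(\<lambda>t. (p (linepath 1 z t) - 1) / linepath 1 z t * (z - 1)) integrable_on {0..1}"
  proof (rule integrable_spike_finite[rotated 2])
    show "finite (linepath 1 z -` {0} \<inter> {0..1})"
      using d by (intro finite_vimage_IntI) (auto simp: d_def inj_on_linepath)
  qed (auto simp: h_def F_def p0)
  then show ?thesis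
    by (simp add: contour_integrable_on p_def vector_derivative_linepath_at)
qed

end

theory Submission imports Defs begin

text \<open>
Write \<open>p\<close> for the power in the integrand and \<open>g\<close> for the map. Then \<open>\<zeta> g'(\<zeta>) / g(\<zeta>) = p(\<zeta>)\<close>,
and \<open>p = cis lam * q powr \<alpha>\<close> where \<open>q\<close> maps the disc into the right half-plane. Hence the values
of \<open>p\<close> lie in the sector of half-angle \<open>\<beta> = pi * \<alpha> / 2\<close> around the direction \<open>cis lam\<close>, and on the
unit circle the argument of \<open>p\<close> is \<open>lam + \<beta>\<close> on one arc and \<open>lam - \<beta>\<close> on the other.

Boundary curve. Since \<open>\<bar>p(\<zeta>)\<bar> \<le> 2 powr \<alpha> * \<bar>1 - \<zeta>\<bar> powr - \<alpha>\<close> and \<open>\<alpha> < 1\<close>, the logarithm of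
\<open>g(\<zeta>) / \<zeta>\<close> is Hoelder continuous and extends continuously to the closed disc
(\<open>logarithm_exists\<close>). On the circle \<open>\<zeta> = cis t\<close>, the \<open>t\<close>-derivative of \<open>log g\<close> is
\<open>\<i> p\<close>; so \<open>log g\<close> runs along two straight segments, and \<open>g\<close> along two arcs of logarithmic
spirals. This is made precise without boundary derivatives: the sector condition makes certain
real-linear functionals of \<open>log g\<close> monotone along the circles of radius less than \<open>1\<close>, hence on
the unit circle, and the two functionals that define the segments are constant there on the
respective arc. In the spiral coordinates \<open>\<rho>\<close>, \<open>\<theta>\<close> with
\<open>log w = (1 + \<i> tan lam) \<rho> + \<i> \<theta>\<close>, the result is that the circle is mapped into the curve
\<open>\<rho> = max (B \<theta>) (- A (2 pi - \<theta>))\<close>, \<open>0 \<le> \<theta> \<le> 2 pi\<close> (\<open>log_curve_profile\<close>), which is the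
boundary of the spirallike domain \<open>U\<close>.

Bijectivity. The map \<open>g\<close> is locally injective, because its derivative is \<open>p\<close> times an exponential
and has no zero, and \<open>U\<close> is connected and disjoint from the image of the circle. Therefore the image
of the open disc meets \<open>U\<close> in a set that is open and closed in \<open>U\<close>, and the set of the points of
\<open>U\<close> with at least two preimages is open and closed in \<open>U\<close> as well. As \<open>0\<close> has exactly one
preimage, \<open>g\<close> covers every point of \<open>U\<close> exactly once (\<open>connected_subset_image_ball\<close>,
\<open>inj_on_preimage_of_connected\<close>). A value of \<open>g\<close> outside \<open>U\<close> could be pushed outwards along its
spiral off the boundary curve, and then the whole unbounded spiral ray beyond it would lie in the
bounded image of the disc; hence \<open>g\<close> maps into \<open>U\<close>.
\<close>

section \<open>Open maps of the disc over a connected set\<close>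

text \<open>The image of the open disc is closed relative to \<open>S\<close> because there it agrees with the compact
image of the closed disc.\<close>

lemma connected_subset_image_ball:
  fixes G :: "complex \<Rightarrow> complex"
  assumes contG: "continuous_on (cball 0 1) G" and openG: "open (G ` ball 0 1)"
    and S: "connected S" "S \<inter> G ` sphere 0 1 = {}" "S \<inter> G ` ball 0 1 \<noteq> {}"
  shows "S \<subseteq> G ` ball 0 1"
proof -
  have "closed (G ` cball 0 1)"
    by (intro compact_imp_closed compact_continuous_image contG) auto
  moreover have eq: "S \<inter> G ` ball 0 1 = S \<inter> G ` cball 0 1"
    using S(2) by (force simp: ball_def cball_def sphere_def)
  ultimately have "closedin (top_of_set S) (S \<inter> G ` ball 0 1)"
    by (simp add: closedin_closed_Int)
  moreover have "openin (top_of_set S) (S \<inter> G ` ball 0 1)"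
    by (simp add: openG openin_open_Int)
  ultimately have "S \<inter> G ` ball 0 1 = {} \<or> S \<inter> G ` ball 0 1 = S"
    using S(1)[unfolded connected_clopen, rule_format, of "S \<inter> G ` ball 0 1"] by simp
  with S(3) show ?thesis by auto
qed

text \<open>The points of \<open>S\<close> with at least two preimages form a set that is open and closed in \<open>S\<close>:
open since \<open>G\<close> is an open map, closed since two sequences of preimages of the same points have
limits in the open disc (along a subsequence), which are distinct by local injectivity.\<close>

lemma inj_on_preimage_of_connected:
  fixes G :: "complex \<Rightarrow> complex"
  assumes contG: "continuous_on (cball 0 1) G"
    and openG: "\<And>V. open V \<Longrightarrow> V \<subseteq> ball 0 1 \<Longrightarrow> open (G ` V)"
    and inj: "\<And>a. a \<in> ball 0 1 \<Longrightarrow> \<exists>r>0. inj_on G (ball a r)"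
    and S: "connected S" "S \<inter> G ` sphere 0 1 = {}"
    and w0: "w0 \<in> S" "\<And>z z'. z \<in> ball 0 1 \<Longrightarrow> z' \<in> ball 0 1 \<Longrightarrow> G z = w0 \<Longrightarrow> G z' = w0 \<Longrightarrow> z = z'"
  shows "inj_on G (ball 0 1 \<inter> G -` S)"
proof -
  define T where "T = {w \<in> S. \<exists>z\<in>ball 0 1. \<exists>z'\<in>ball 0 1. z \<noteq> z' \<and> G z = w \<and> G z' = w}"
  have openT: "openin (top_of_set S) T"
  proof (subst openin_subopen, intro ballI)
    fix w assume "w \<in> T"
    then obtain z z' where w: "w \<in> S" "z \<in> ball 0 1" "z' \<in> ball 0 1" "z \<noteq> z'" "G z = w" "G z' = w"
      unfolding T_def by blast
    obtain N N' where N: "open N" "open N'" "z \<in> N" "z' \<in> N'" "N \<inter> N' = {}"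
      using hausdorff[OF w(4)] by blast
    define W where "W = G ` (N \<inter> ball 0 1) \<inter> G ` (N' \<inter> ball 0 1)"
    have "open W" unfolding W_def using N by (intro open_Int openG) auto
    then have "openin (top_of_set S) (S \<inter> W)" by (rule openin_open_Int)
    moreover have "w \<in> S \<inter> W"
      using w(1) imageI[of z "N \<inter> ball 0 1" G] imageI[of z' "N' \<inter> ball 0 1" G] w(2,3,5,6) N(3,4)
      unfolding W_def by auto
    moreover have "S \<inter> W \<subseteq> T"
    proof
      fix u assume "u \<in> S \<inter> W"
      then obtain x y where xy: "u \<in> S" "x \<in> N \<inter> ball 0 1" "y \<in> N' \<inter> ball 0 1" "G x = u" "G y = u"
        unfolding W_def by auto
      then have "x \<noteq> y" using N(5) by auto
      with xy show "u \<in> T" unfolding T_def by blast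
    qed
    ultimately show "\<exists>T'. openin (top_of_set S) T' \<and> w \<in> T' \<and> T' \<subseteq> T" by blast
  qed
  have closT: "T = S \<inter> closure T"
  proof (intro equalityI subsetI)
    fix w assume "w \<in> T"
    then show "w \<in> S \<inter> closure T"
      using closure_subset[of T] by (auto simp: T_def)
  next
    fix w assume w: "w \<in> S \<inter> closure T"
    then have "\<exists>x. (\<forall>n. x n \<in> T) \<and> x \<longlonglongrightarrow> w"
      by (simp add: closure_sequential)
    then obtain x where x: "\<And>n. x n \<in> T" "x \<longlonglongrightarrow> w" by auto
    have "\<exists>q. fst q \<in> ball 0 1 \<and> snd q \<in> ball 0 1 \<and> fst q \<noteq> snd q \<and> G (fst q) = x n \<and> G (snd q) = x n" for n
    proof -
      obtain z z' where "z \<in> ball 0 1" "z' \<in> ball 0 1" "z \<noteq> z'" "G z = x n" "G z' = x n"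
        using x(1)[of n] unfolding T_def by blast
      then show ?thesis by (intro exI[of _ "(z, z')"]) simp
    qed
    then obtain q where "\<forall>n. fst (q n) \<in> ball 0 1 \<and> snd (q n) \<in> ball 0 1 \<and> fst (q n) \<noteq> snd (q n)
        \<and> G (fst (q n)) = x n \<and> G (snd (q n)) = x n"
      using choice[of "\<lambda>n q. fst q \<in> ball 0 1 \<and> snd q \<in> ball 0 1 \<and> fst q \<noteq> snd q
        \<and> G (fst q) = x n \<and> G (snd q) = x n"] by blast
    then have q: "fst (q n) \<in> ball 0 1" "snd (q n) \<in> ball 0 1" "fst (q n) \<noteq> snd (q n)"
        "G (fst (q n)) = x n" "G (snd (q n)) = x n" for n by auto
    have "compact (cball (0::complex) 1 \<times> cball (0::complex) 1)" by (intro compact_Times) auto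
    moreover have "\<And>n. q n \<in> cball 0 1 \<times> cball 0 1"
      using q(1,2) by (auto simp: mem_Times_iff less_imp_le)
    ultimately obtain l r where l: "l \<in> cball 0 1 \<times> cball 0 1" "strict_mono r" "(q \<circ> r) \<longlonglongrightarrow> l"
      unfolding compact_def by blast
    obtain a b where ab: "l = (a, b)" by (cases l)
    have a: "(\<lambda>n. fst (q (r n))) \<longlonglongrightarrow> a" and b: "(\<lambda>n. snd (q (r n))) \<longlonglongrightarrow> b"
      using tendsto_fst[OF l(3)] tendsto_snd[OF l(3)] ab by (auto simp: o_def)
    have xr: "(\<lambda>n. x (r n)) \<longlonglongrightarrow> w"
      using LIMSEQ_subseq_LIMSEQ[OF x(2) l(2)] by (simp add: o_def)
    have lim: "G c = w" if "c \<in> cball 0 1" "y \<longlonglongrightarrow> c" "\<And>n. y n \<in> ball 0 1" "\<And>n. G (y n) = x (r n)" for c y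
    proof -
      have "(\<lambda>n. G (y n)) \<longlonglongrightarrow> G c"
        by (rule continuous_on_tendsto_compose[OF contG that(2,1)])
           (use that(3) ball_subset_cball in \<open>auto simp: less_imp_le\<close>)
      then show ?thesis using that(4) xr by (simp add: LIMSEQ_unique)
    qed
    have Ga: "G a = w" using lim[OF _ a] l(1) ab q by auto
    have Gb: "G b = w" using lim[OF _ b] l(1) ab q by auto
    have "a \<notin> sphere 0 1" "b \<notin> sphere 0 1"
      using S(2) Ga Gb w imageI[of a "sphere 0 1" G] imageI[of b "sphere 0 1" G] by auto
    then have ball: "a \<in> ball 0 1" "b \<in> ball 0 1" using l(1) ab by auto
    \<comment> \<open>If the two limits coincided, \<open>G\<close> would fail to be injective near that point.\<close>
    have "a \<noteq> b"
    proof
      assume "a = b"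
      obtain e where e: "e > 0" "inj_on G (ball a e)" using inj ball by blast
      have "\<forall>\<^sub>F n in sequentially. dist (fst (q (r n))) a < e \<and> dist (snd (q (r n))) a < e"
        using tendstoD[OF a e(1)] tendstoD[OF b e(1)] \<open>a = b\<close> by (simp add: eventually_conj)
      then obtain n where "dist (fst (q (r n))) a < e" "dist (snd (q (r n))) a < e"
        unfolding eventually_sequentially by blast
      then have "fst (q (r n)) \<in> ball a e" "snd (q (r n)) \<in> ball a e"
        by (simp_all add: dist_commute)
      then have "fst (q (r n)) = snd (q (r n))"
        using inj_onD[OF e(2)] q(4,5) by simp
      then show False using q(3) by simp
    qed
    then show "w \<in> T" using w Ga Gb ball unfolding T_def by blast
  qed
  have "closedin (top_of_set S) T"
    by (subst closT) (simp add: closedin_closed_Int)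
  moreover have "w0 \<notin> T" using w0(2) unfolding T_def by blast
  ultimately have "T = {}"
    using S(1)[unfolded connected_clopen, rule_format, of T] w0(1) openT by auto
  show ?thesis
  proof (rule inj_onI, rule ccontr)
    fix z z' assume "z \<in> ball 0 1 \<inter> G -` S" "z' \<in> ball 0 1 \<inter> G -` S" "G z = G z'" "z \<noteq> z'"
    then have "G z \<in> T"
      unfolding T_def by (intro CollectI conjI bexI[of _ z] bexI[of _ z']) auto
    with \<open>T = {}\<close> show False by simp
  qed
qed

section \<open>Continuous extension under an integrable derivative bound\<close>

text \<open>The derivative is compared with the integrable singularity \<open>M * \<bar>t - s\<bar> powr - \<alpha>\<close> on both sides
of \<open>s\<close>.\<close>

lemma norm_diff_le_of_singular_derivative:
  fixes f :: "real \<Rightarrow> complex"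
  assumes a: "0 < \<alpha>" "\<alpha> < 1" and "0 \<le> M"
    and f: "\<And>t. t \<in> {0..1} \<Longrightarrow> (f has_vector_derivative f' t) (at t)"
    and s: "0 \<le> s" "s \<le> 1"
    and bd: "\<And>t. t \<in> {0..1} \<Longrightarrow> t \<noteq> s \<Longrightarrow> norm (f' t) \<le> M * \<bar>t - s\<bar> powr - \<alpha>"
  shows "norm (f 1 - f 0) \<le> 2 * M / (1 - \<alpha>)"
proof -
  have cont: "continuous_on {u..v} f" if "0 \<le> u" "v \<le> 1" for u v
    using that by (intro continuous_at_imp_continuous_on ballI has_vector_derivative_continuous[OF f]) auto
  have 1: "norm (f 1 - f s) \<le> M / (1 - \<alpha>)"
  proof (cases "s < 1")
    case True
    have "norm (f 1 - f s) \<le> M / (1 - \<alpha>) * (1 - s) powr (1 - \<alpha>) - M / (1 - \<alpha>) * (s - s) powr (1 - \<alpha>)"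
    proof (rule differentiable_bound_general[OF True, where f' = f' and \<phi>' = "\<lambda>t. M * (t - s) powr - \<alpha>"])
      show "continuous_on {s..1} (\<lambda>t. M / (1 - \<alpha>) * (t - s) powr (1 - \<alpha>))"
        using a by (intro continuous_intros continuous_on_powr') auto
      fix t assume t: "s < t" "t < 1"
      show "((\<lambda>t. M / (1 - \<alpha>) * (t - s) powr (1 - \<alpha>)) has_vector_derivative M * (t - s) powr - \<alpha>) (at t)"
        unfolding has_real_derivative_iff_has_vector_derivative[symmetric]
        using t a by (auto intro!: derivative_eq_intros)
      show "norm (f' t) \<le> M * (t - s) powr - \<alpha>" using bd[of t] t s by auto
    qed (use cont s f in auto)
    also have "\<dots> \<le> M / (1 - \<alpha>) * 1"
      using s a \<open>0 \<le> M\<close> True by (simp add: divide_right_mono mult_left_le powr_le1)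
    finally show ?thesis by simp
  qed (use s a \<open>0 \<le> M\<close> in auto)
  have 2: "norm (f s - f 0) \<le> M / (1 - \<alpha>)"
  proof (cases "0 < s")
    case True
    have "norm (f s - f 0) \<le> - (M / (1 - \<alpha>)) * (s - s) powr (1 - \<alpha>) - - (M / (1 - \<alpha>)) * (s - 0) powr (1 - \<alpha>)"
    proof (rule differentiable_bound_general[OF True, where f' = f' and \<phi>' = "\<lambda>t. M * (s - t) powr - \<alpha>"])
      show "continuous_on {0..s} (\<lambda>t. - (M / (1 - \<alpha>)) * (s - t) powr (1 - \<alpha>))"
        using a by (intro continuous_intros continuous_on_powr') auto
      fix t assume t: "0 < t" "t < s"
      show "((\<lambda>t. - (M / (1 - \<alpha>)) * (s - t) powr (1 - \<alpha>)) has_vector_derivative M * (s - t) powr - \<alpha>) (at t)"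
        unfolding has_real_derivative_iff_has_vector_derivative[symmetric]
        using t a by (auto intro!: derivative_eq_intros)
      show "norm (f' t) \<le> M * (s - t) powr - \<alpha>" using bd[of t] t s by auto
    qed (use cont s f in auto)
    also have "\<dots> \<le> M / (1 - \<alpha>) * 1"
      using s a \<open>0 \<le> M\<close> True by (simp add: divide_right_mono mult_left_le powr_le1)
    finally show ?thesis by simp
  qed (use s a \<open>0 \<le> M\<close> in auto)
  have "norm (f 1 - f 0) \<le> norm (f 1 - f s) + norm (f s - f 0)"
    using norm_triangle_ineq[of "f 1 - f s" "f s - f 0"] by simp
  with 1 2 show ?thesis by simp
qed

text \<open>A point of the segment from \<open>z\<close> to \<open>w\<close> is at least as far from \<open>c\<close> as from the orthogonal
projection of \<open>c\<close> onto the line through the segment. This reduces the estimate to the preceding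
one-dimensional one.\<close>

lemma hoelder_of_derivative_bound:
  fixes H :: "complex \<Rightarrow> complex"
  assumes a: "0 < \<alpha>" "\<alpha> < 1" and S: "convex S" and c: "c \<notin> S"
    and H: "\<And>z. z \<in> S \<Longrightarrow> (H has_field_derivative h z) (at z)"
    and bd: "\<And>z. z \<in> S \<Longrightarrow> norm (h z) \<le> K * norm (z - c) powr - \<alpha>"
    and zw: "z \<in> S" "w \<in> S"
  shows "norm (H w - H z) \<le> 2 * K / (1 - \<alpha>) * norm (w - z) powr (1 - \<alpha>)"
proof (cases "z = w")
  case False
  define d where "d = norm (w - z)"
  have d: "d > 0" using False by (simp add: d_def)
  have "0 < norm (z - c) powr - \<alpha>" using zw c by auto
  then have K: "0 \<le> K" using bd[OF zw(1)] by (metis norm_ge_zero order_trans zero_le_mult_iff not_less)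
  \<comment> \<open>the parameter of the projection of \<open>c\<close>, and its nearest point in the unit interval\<close>
  define s0 where "s0 = Re ((c - z) / (w - z))"
  define s where "s = max 0 (min 1 s0)"
  define \<gamma> where "\<gamma> = (\<lambda>t::real. z + of_real t * (w - z))"
  have \<gamma>: "\<gamma> t \<in> S" if "t \<in> {0..1}" for t
  proof -
    have "\<gamma> t = (1 - t) *\<^sub>R z + t *\<^sub>R w" by (simp add: \<gamma>_def scaleR_conv_of_real algebra_simps)
    then show ?thesis using S zw that by (simp add: convex_def)
  qed
  have "norm (H (\<gamma> 1) - H (\<gamma> 0)) \<le> 2 * (K * d powr (1 - \<alpha>)) / (1 - \<alpha>)"
  proof (rule norm_diff_le_of_singular_derivative[OF a, where s = s and f' = "\<lambda>t. h (\<gamma> t) * (w - z)"])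
    fix t :: real assume t: "t \<in> {0..1}"
    have "(\<gamma> has_vector_derivative (w - z)) (at t)"
      unfolding \<gamma>_def by (auto intro!: derivative_eq_intros)
    from field_vector_diff_chain_at[OF this H[OF \<gamma>[OF t]]]
    show "((\<lambda>t. H (\<gamma> t)) has_vector_derivative h (\<gamma> t) * (w - z)) (at t)"
      by (simp add: o_def mult.commute)
    assume ts: "t \<noteq> s"
    have "\<bar>t - s\<bar> \<le> \<bar>t - s0\<bar>" using t by (auto simp: s_def)
    also have "\<dots> = \<bar>Re (of_real t - (c - z) / (w - z))\<bar>" by (simp add: s0_def)
    also have "\<dots> \<le> norm (of_real t - (c - z) / (w - z))" by (rule abs_Re_le_cmod)
    also have "of_real t - (c - z) / (w - z) = (\<gamma> t - c) / (w - z)"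
      using False by (simp add: \<gamma>_def field_simps)
    also have "norm \<dots> = norm (\<gamma> t - c) / d" by (simp add: norm_divide d_def)
    finally have "d * \<bar>t - s\<bar> \<le> norm (\<gamma> t - c)" using d by (simp add: field_simps)
    then have "norm (\<gamma> t - c) powr - \<alpha> \<le> (d * \<bar>t - s\<bar>) powr - \<alpha>"
      using ts d a by (intro powr_mono2') auto
    also have "\<dots> = d powr - \<alpha> * \<bar>t - s\<bar> powr - \<alpha>" using d by (simp add: powr_mult)
    finally have "norm (h (\<gamma> t)) \<le> K * (d powr - \<alpha> * \<bar>t - s\<bar> powr - \<alpha>)"
      using bd[OF \<gamma>[OF t]] K by (meson mult_left_mono order_trans)
    then have "norm (h (\<gamma> t)) * d \<le> K * (d powr - \<alpha> * \<bar>t - s\<bar> powr - \<alpha>) * d"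
      using d by simp
    also have "\<dots> = K * d powr (1 - \<alpha>) * \<bar>t - s\<bar> powr - \<alpha>"
      using d powr_add[of d 1 "-\<alpha>"] by simp
    finally show "norm (h (\<gamma> t) * (w - z)) \<le> K * d powr (1 - \<alpha>) * \<bar>t - s\<bar> powr - \<alpha>"
      by (simp add: norm_mult d_def)
  qed (use K d in \<open>auto simp: s_def\<close>)
  then show ?thesis by (simp add: \<gamma>_def d_def mult.assoc)
qed auto

lemma continuous_extension_of_derivative_bound:
  fixes H :: "complex \<Rightarrow> complex"
  assumes a: "0 < \<alpha>" "\<alpha> < 1" and S: "convex S" and c: "c \<notin> S"
    and H: "\<And>z. z \<in> S \<Longrightarrow> (H has_field_derivative h z) (at z)"
    and bd: "\<And>z. z \<in> S \<Longrightarrow> norm (h z) \<le> K * norm (z - c) powr - \<alpha>"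
  obtains E where "continuous_on (closure S) E" "\<And>z. z \<in> S \<Longrightarrow> E z = H z"
proof -
  have "uniformly_continuous_on S H"
    unfolding uniformly_continuous_on_def
  proof (intro allI impI)
    fix e :: real assume e: "e > 0"
    define L where "L = 2 * \<bar>K\<bar> / (1 - \<alpha>) + 1"
    have L: "L > 0" using a by (simp add: L_def add_nonneg_pos)
    define d where "d = (e / L) powr (1 / (1 - \<alpha>))"
    have "dist (H w) (H z) < e" if "z \<in> S" "w \<in> S" "dist w z < d" for z w
    proof (cases "z = w")
      case False
      have "norm (H w - H z) \<le> 2 * K / (1 - \<alpha>) * norm (w - z) powr (1 - \<alpha>)"
        by (rule hoelder_of_derivative_bound[OF a S c H bd that(1,2)])
      also have "\<dots> \<le> L * norm (w - z) powr (1 - \<alpha>)"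
      proof (rule mult_right_mono)
        have "2 * K / (1 - \<alpha>) \<le> 2 * \<bar>K\<bar> / (1 - \<alpha>)"
          using a by (intro divide_right_mono) auto
        then show "2 * K / (1 - \<alpha>) \<le> L" unfolding L_def by linarith
      qed simp
      also have "\<dots> < L * d powr (1 - \<alpha>)"
        using that(3) L a by (intro mult_strict_left_mono powr_less_mono2) (auto simp: dist_norm)
      also have "\<dots> = e" using a e L by (simp add: d_def powr_powr)
      finally show ?thesis by (simp add: dist_norm)
    qed (use e in auto)
    moreover have "d > 0" using e L by (simp add: d_def)
    ultimately show "\<exists>d>0. \<forall>x\<in>S. \<forall>x'\<in>S. dist x' x < d \<longrightarrow> dist (H x') (H x) < e" by blast
  qed
  then show ?thesis
  proof (rule uniformly_continuous_on_extension_on_closure)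
    fix E assume "uniformly_continuous_on (closure S) E" "\<And>x. x \<in> S \<Longrightarrow> H x = E x"
    then show ?thesis
      by (intro that[of E]) (simp_all add: uniformly_continuous_imp_continuous)
  qed
qed

section \<open>The power and its sector\<close>

text \<open>The base of the power, turned by the angle \<open>- \<mu>\<close> with \<open>\<mu> = lam / \<alpha>\<close>: it maps the unit disc into
the right half-plane and the circle without \<open>1\<close> into the imaginary axis.\<close>

definition half_plane_base :: "real \<Rightarrow> complex \<Rightarrow> complex" where
  "half_plane_base \<mu> z = (cis (- \<mu>) + cis \<mu> * z) / (1 - z)"

lemma Re_half_plane_base_nonneg:
  assumes \<mu>: "\<bar>\<mu>\<bar> < pi / 2" and z: "norm z \<le> 1"
  shows "0 \<le> Re (half_plane_base \<mu> z)" and "norm z < 1 \<Longrightarrow> 0 < Re (half_plane_base \<mu> z)"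
proof -
  have cos: "0 < cos \<mu>" using \<mu> by (intro cos_gt_zero_pi) auto
  have eq: "Re (half_plane_base \<mu> z) = cos \<mu> * (1 - (norm z)\<^sup>2) / (norm (1 - z))\<^sup>2"
    unfolding half_plane_base_def complex_div_cnj[of _ "1 - z"] cmod_power2
    by (simp add: Re_divide_of_real algebra_simps power2_eq_square)
  show "0 \<le> Re (half_plane_base \<mu> z)"
    using cos z by (simp add: eq power_le_one)
  assume "norm z < 1"
  then have "z \<noteq> 1" "(norm z)\<^sup>2 < 1" by (auto simp: power_less_one_iff)
  then show "0 < Re (half_plane_base \<mu> z)" using cos by (simp add: eq)
qed

lemma half_plane_base_cis:
  assumes "sin (t / 2) \<noteq> 0"
  shows "half_plane_base \<mu> (cis t) = \<i> * of_real (cos (\<mu> + t / 2) / sin (t / 2))"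
proof -
  have t: "cis t = cis (t / 2) * cis (t / 2)" by (simp add: cis_mult)
  have num: "cis (- \<mu>) + cis \<mu> * cis t = cis (t / 2) * of_real (2 * cos (\<mu> + t / 2))"
  proof -
    have "of_real (2 * cos (\<mu> + t / 2)) = cis (\<mu> + t / 2) + cis (- (\<mu> + t / 2))"
      by (simp add: complex_eq_iff del: minus_add_distrib)
    then show ?thesis by (simp add: distrib_left cis_mult algebra_simps)
  qed
  have den: "1 - cis t = cis (t / 2) * (- \<i> * of_real (2 * sin (t / 2)))"
  proof -
    have "- \<i> * of_real (2 * sin (t / 2)) = cis (- (t / 2)) - cis (t / 2)"
      by (simp add: complex_eq_iff)
    then show ?thesis by (simp add: right_diff_distrib cis_mult)
  qed
  show ?thesis
    unfolding half_plane_base_def num den using assms by (simp add: field_simps)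
qed

lemma Re_cis_mult_powr:
  assumes "p \<noteq> 0"
  shows "Re (cis \<delta> * p powr of_real \<alpha>) = norm p powr \<alpha> * cos (\<delta> + \<alpha> * Arg p)"
proof -
  have "p powr of_real \<alpha> = of_real (norm p powr \<alpha>) * cis (\<alpha> * Arg p)"
    using assms by (simp add: powr_def Ln_Arg cis_conv_exp exp_add[symmetric] exp_of_real[symmetric] algebra_simps)
  then show ?thesis by (simp add: cos_add algebra_simps)
qed

lemma Re_cis_mult_powr_nonneg:
  assumes p: "p \<noteq> 0" "0 \<le> Re p" and \<alpha>: "0 \<le> \<alpha>" and \<delta>: "\<bar>\<delta>\<bar> \<le> pi / 2 - pi * \<alpha> / 2"
  shows "0 \<le> Re (cis \<delta> * p powr of_real \<alpha>)"
proof -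
  have "\<bar>Arg p\<bar> \<le> pi / 2" using p Arg_Re_nonneg by blast
  then have "\<alpha> * \<bar>Arg p\<bar> \<le> \<alpha> * (pi / 2)" using \<alpha> by (rule mult_left_mono)
  then have "\<bar>\<alpha> * Arg p\<bar> \<le> pi * \<alpha> / 2" using \<alpha> by (simp add: abs_mult mult.commute)
  then have "0 \<le> cos (\<delta> + \<alpha> * Arg p)" using \<delta> by (intro cos_ge_zero) linarith+
  then show ?thesis using Re_cis_mult_powr[OF p(1)] by simp
qed

text \<open>The hypotheses on the two parameters. Here \<open>\<beta>\<close> is half the opening angle of the sector that
contains the values of the power, and \<open>\<mu>\<close> is the angle by which its base is turned.\<close>

locale spiral_parameters =
  fixes lam \<alpha> :: real
  assumes lam: "\<bar>lam\<bar> < pi * \<alpha> / 2" and al: "pi * \<alpha> / 2 < pi / 2"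
begin

definition "\<beta> = pi * \<alpha> / 2"
definition "\<mu> = lam / \<alpha>"

lemma alpha: "0 < \<alpha>" "\<alpha> < 1"
proof -
  have "0 < pi * \<alpha>" using lam abs_ge_zero[of lam] by linarith
  then show "0 < \<alpha>" "\<alpha> < 1" using al by (auto simp: zero_less_mult_iff)
qed

lemma beta: "0 < \<beta>" "\<beta> < pi / 2" "\<bar>lam\<bar> < \<beta>" "lam < \<beta>" "- \<beta> < lam"
  using lam al alpha by (auto simp: \<beta>_def)

lemma mu: "\<bar>\<mu>\<bar> < pi / 2" "\<alpha> * \<mu> = lam"
  using lam alpha by (auto simp: \<mu>_def field_simps)

lemma cos_pos: "0 < cos lam" "0 < cos \<beta>"
  using beta by (auto intro!: cos_gt_zero_pi)

lemma spiral_power_eq: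
  assumes z: "norm z \<le> 1" and p: "half_plane_base \<mu> z \<noteq> 0"
  shows "spiral_power lam \<alpha> z = cis lam * half_plane_base \<mu> z powr of_real \<alpha>"
proof -
  define p where "p = half_plane_base \<mu> z"
  have "p \<noteq> 0" "0 \<le> Re p" using p Re_half_plane_base_nonneg[OF mu(1) z] by (auto simp: p_def)
  then have Imp: "\<bar>Im (Ln p)\<bar> \<le> pi / 2"
    using Arg_Re_nonneg Arg_def by metis
  have "exp (2 * \<i> * of_real lam / of_real \<alpha>) = cis \<mu> * cis \<mu>"
    using alpha by (simp add: \<mu>_def cis_mult) (simp add: cis_conv_exp mult_ac)
  then have base: "(1 + z * exp (2 * \<i> * of_real lam / of_real \<alpha>)) / (1 - z) = cis \<mu> * p"
    by (simp add: p_def half_plane_base_def distrib_left cis_mult algebra_simps)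
  \<comment> \<open>The angles add up to less than \<open>pi\<close>, so the principal branches are compatible.\<close>
  have "Ln (cis \<mu> * p) = Ln (exp (\<i> * of_real \<mu> + Ln p))"
    using \<open>p \<noteq> 0\<close> by (simp add: exp_add cis_conv_exp)
  also have "\<dots> = \<i> * of_real \<mu> + Ln p"
    using Imp mu(1) by (intro Ln_exp) auto
  finally have "(cis \<mu> * p) powr of_real \<alpha> = exp (of_real \<alpha> * (\<i> * of_real \<mu> + Ln p))"
    using \<open>p \<noteq> 0\<close> by (simp add: powr_def)
  also have "\<dots> = exp (\<i> * of_real (\<alpha> * \<mu>)) * exp (of_real \<alpha> * Ln p)"
    by (simp add: exp_add[symmetric] algebra_simps)
  also have "\<dots> = cis lam * p powr of_real \<alpha>"
    using \<open>p \<noteq> 0\<close> by (simp add: mu powr_def cis_conv_exp)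
  finally show ?thesis unfolding spiral_power_def base p_def .
qed

lemma half_plane_base_nonzero:
  "norm z < 1 \<Longrightarrow> half_plane_base \<mu> z \<noteq> 0"
  using Re_half_plane_base_nonneg(2)[OF mu(1), of z] by auto

lemma spiral_power_nonzero: "norm z < 1 \<Longrightarrow> spiral_power lam \<alpha> z \<noteq> 0"
  using half_plane_base_nonzero by (simp add: spiral_power_eq)

text \<open>The sector condition, in the form of the half-planes that contain the sector: \<open>\<delta> = 0\<close> and the
two extreme values of \<open>\<delta>\<close> are used below.\<close>

lemma spiral_power_sector:
  assumes z: "norm z < 1" and \<delta>: "\<bar>\<delta>\<bar> \<le> pi / 2 - \<beta>"
  shows "0 \<le> Re (cis (\<delta> - lam) * spiral_power lam \<alpha> z)"
proof -
  have "cis (\<delta> - lam) * spiral_power lam \<alpha> z = cis \<delta> * half_plane_base \<mu> z powr of_real \<alpha>"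
    using z half_plane_base_nonzero[OF z]
    by (simp add: spiral_power_eq mult.assoc[symmetric] cis_mult)
  then show ?thesis
    using Re_cis_mult_powr_nonneg[of "half_plane_base \<mu> z" \<alpha> \<delta>] z \<delta> alpha
      half_plane_base_nonzero[OF z] Re_half_plane_base_nonneg(1)[OF mu(1), of z]
    by (simp add: \<beta>_def)
qed

text \<open>On each of the two boundary arcs the power lies on one edge of the sector; the sign of
\<open>cos (\<mu> + t / 2)\<close> tells which.\<close>

lemma spiral_power_boundary:
  assumes t: "0 < t" "t < 2 * pi" and z: "cos (\<mu> + t / 2) \<noteq> 0"
  shows "Re (cis (sgn (cos (\<mu> + t / 2)) * (pi / 2 - \<beta>) - lam) * spiral_power lam \<alpha> (cis t)) = 0"
    and "half_plane_base \<mu> (cis t) \<noteq> 0"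
proof -
  have s: "0 < sin (t / 2)" using t by (intro sin_gt_zero) auto
  define x where "x = cos (\<mu> + t / 2) / sin (t / 2)"
  have p: "half_plane_base \<mu> (cis t) = \<i> * of_real x"
    unfolding x_def using s by (intro half_plane_base_cis) auto
  have x: "x \<noteq> 0" using z s by (simp add: x_def)
  then show nz: "half_plane_base \<mu> (cis t) \<noteq> 0" by (simp add: p)
  define \<sigma> where "\<sigma> = sgn x"
  have \<sigma>: "sgn (cos (\<mu> + t / 2)) = \<sigma>"
    using s by (simp add: \<sigma>_def x_def sgn_divide)
  have "Arg (\<i> * of_real x) = \<sigma> * (pi / 2)"
  proof (cases "x > 0")
    case True
    then have "Arg (of_real x * \<i>) = Arg \<i>" by (intro Arg_times_of_real) auto
    with True show ?thesis by (simp add: \<sigma>_def mult.commute)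
  next
    case False
    then have "Arg (of_real (- x) * (- \<i>)) = Arg (- \<i>)" using x by (intro Arg_times_of_real) auto
    with False x show ?thesis by (simp add: \<sigma>_def mult.commute)
  qed
  note argx = this
  have eq: "cis (\<sigma> * (pi / 2 - \<beta>) - lam) * spiral_power lam \<alpha> (cis t)
      = cis (\<sigma> * (pi / 2 - \<beta>)) * (\<i> * of_real x) powr of_real \<alpha>"
    using spiral_power_eq[of "cis t"] nz p by (simp add: mult.assoc[symmetric] cis_mult)
  have "Re (cis (\<sigma> * (pi / 2 - \<beta>) - lam) * spiral_power lam \<alpha> (cis t))
      = norm (\<i> * of_real x) powr \<alpha> * cos (\<sigma> * (pi / 2 - \<beta>) + \<alpha> * (\<sigma> * (pi / 2)))"
    unfolding eq using x by (subst Re_cis_mult_powr) (simp_all add: argx)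
  also have "\<sigma> * (pi / 2 - \<beta>) + \<alpha> * (\<sigma> * (pi / 2)) = \<sigma> * (pi / 2)"
    by (simp add: \<beta>_def algebra_simps)
  also have "cos (\<sigma> * (pi / 2)) = 0" using x by (auto simp: \<sigma>_def sgn_if)
  finally show "Re (cis (sgn (cos (\<mu> + t / 2)) * (pi / 2 - \<beta>) - lam) * spiral_power lam \<alpha> (cis t)) = 0"
    by (simp add: \<sigma>)
qed

lemma continuous_on_spiral_power:
  "continuous_on {z \<in> cball 0 1. z \<noteq> 1 \<and> half_plane_base \<mu> z \<noteq> 0} (spiral_power lam \<alpha>)"
proof -
  have "continuous_on {z \<in> cball 0 1. z \<noteq> 1 \<and> half_plane_base \<mu> z \<noteq> 0}
      (\<lambda>z. cis lam * half_plane_base \<mu> z powr of_real \<alpha>)"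
  proof (intro continuous_on_mult continuous_on_const continuous_on_powr_complex)
    show "continuous_on {z \<in> cball 0 1. z \<noteq> 1 \<and> half_plane_base \<mu> z \<noteq> 0} (half_plane_base \<mu>)"
      unfolding half_plane_base_def by (intro continuous_intros) auto
    show "{z \<in> cball 0 1. z \<noteq> 1 \<and> half_plane_base \<mu> z \<noteq> 0}
        \<subseteq> {z. 0 \<le> Re (half_plane_base \<mu> z) \<or> Im (half_plane_base \<mu> z) \<noteq> 0}"
      using Re_half_plane_base_nonneg(1)[OF mu(1)] by auto
  qed (use alpha in auto)
  then show ?thesis
    by (rule continuous_on_eq) (auto simp: spiral_power_eq)
qed

lemma norm_spiral_power_le:
  assumes "norm z < 1"
  shows "norm (spiral_power lam \<alpha> z) \<le> 2 powr \<alpha> * norm (z - 1) powr - \<alpha>"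
proof -
  have z: "z \<noteq> 1" using assms by auto
  have "norm (1 + z * exp (2 * \<i> * of_real lam / of_real \<alpha>)) \<le> 2"
  proof -
    have "exp (2 * \<i> * of_real lam / of_real \<alpha>) = cis (2 * lam / \<alpha>)"
      by (simp add: cis_conv_exp mult_ac)
    then show ?thesis
      using assms norm_triangle_ineq[of 1 "z * exp (2 * \<i> * of_real lam / of_real \<alpha>)"]
      by (simp add: norm_mult)
  qed
  then have "norm ((1 + z * exp (2 * \<i> * of_real lam / of_real \<alpha>)) / (1 - z)) \<le> 2 / norm (z - 1)"
    by (simp add: norm_divide divide_right_mono norm_minus_commute)
  then have "norm (spiral_power lam \<alpha> z) \<le> (2 / norm (z - 1)) powr \<alpha>"
    using alpha unfolding spiral_power_def by (simp add: norm_powr_real_powr' powr_mono2)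
  also have "\<dots> = 2 powr \<alpha> * norm (z - 1) powr - \<alpha>"
    using z by (simp add: powr_divide powr_minus field_simps)
  finally show ?thesis .
qed

end

section \<open>A logarithm on the closed disc\<close>

context spiral_parameters begin

text \<open>The integrand with its removable singularity at \<open>0\<close> filled in.\<close>

definition integrand :: "complex \<Rightarrow> complex" where
  "integrand z = (if z = 0 then deriv (spiral_power lam \<alpha>) 0 else (spiral_power lam \<alpha> z - 1) / z)"

lemma integrand_holomorphic: "integrand holomorphic_on ball 0 1"
proof -
  have "(\<lambda>z. if z = 0 then deriv (spiral_power lam \<alpha>) 0
      else (spiral_power lam \<alpha> z - spiral_power lam \<alpha> 0) / (z - 0)) holomorphic_on ball 0 1"
    using spiral_power_holomorphic by (intro pole_lemma_open) auto
  then show ?thesis by (simp add: integrand_def[abs_def] spiral_power_0 cong: if_cong)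
qed

lemma times_integrand: "1 + z * integrand z = spiral_power lam \<alpha> z"
  by (simp add: integrand_def spiral_power_0)

lemma norm_integrand_le:
  obtains K where "\<And>z. z \<in> ball 0 1 \<Longrightarrow> norm (integrand z) \<le> K * norm (z - 1) powr - \<alpha>"
proof -
  have "continuous_on (cball 0 (1/2)) integrand"
    using integrand_holomorphic
    by (intro holomorphic_on_imp_continuous_on) (rule holomorphic_on_subset, auto)
  then have "bounded (integrand ` cball 0 (1/2))"
    by (intro compact_imp_bounded compact_continuous_image) auto
  then obtain M where M: "\<And>z. z \<in> cball 0 (1/2) \<Longrightarrow> norm (integrand z) \<le> M" and "M > 0"
    unfolding bounded_pos by blast
  have "norm (integrand z) \<le> (M + 4) * (2 powr \<alpha> * norm (z - 1) powr - \<alpha>)" if z: "z \<in> ball 0 1" for z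
  proof -
    define q where "q = 2 powr \<alpha> * norm (z - 1) powr - \<alpha>"
    have n: "0 < norm (z - 1)" "norm (z - 1) \<le> 2"
      using z norm_triangle_ineq4[of z 1] by auto
    have "1 \<le> (2 / norm (z - 1)) powr \<alpha>"
      using n alpha by (intro ge_one_powr_ge_zero) auto
    then have q1: "1 \<le> q"
      using n by (simp add: q_def powr_divide powr_minus field_simps)
    have q: "norm (spiral_power lam \<alpha> z) \<le> q"
      using norm_spiral_power_le[of z] z by (simp add: q_def)
    show ?thesis
    proof (cases "norm z \<le> 1 / 2")
      case True
      then have "norm (integrand z) \<le> M * 1" using M[of z] by simp
      also have "\<dots> \<le> (M + 4) * q" using q1 \<open>M > 0\<close> by (intro mult_mono) auto
      finally show ?thesis by (simp add: q_def)
    next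
      case False
      have "norm (integrand z) = norm (spiral_power lam \<alpha> z - 1) / norm z"
        using False by (auto simp: integrand_def norm_divide)
      also have "\<dots> \<le> (q + q) / (1 / 2)"
        using False q q1 norm_triangle_ineq4[of "spiral_power lam \<alpha> z" 1]
        by (intro frac_le) auto
      also have "\<dots> \<le> (M + 4) * q" using q1 \<open>M > 0\<close> by (simp add: algebra_simps)
      finally show ?thesis by (simp add: q_def)
    qed
  qed
  then show ?thesis using that[of "(M + 4) * 2 powr \<alpha>"] by (simp add: mult.assoc)
qed

text \<open>\<open>H\<close> is a continuous logarithm of \<open>spiral_map lam \<alpha> z / z\<close> on the closed disc. The contour
integral is recovered from \<open>H\<close> by the fundamental theorem of calculus, which needs only continuity
at the end point \<open>1\<close>.\<close>

lemma logarithm_exists: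
  obtains H where "continuous_on (cball 0 1) H" "H 1 = 0"
    "\<And>z. z \<in> ball 0 1 \<Longrightarrow> (H has_field_derivative integrand z) (at z)"
    "\<And>z. z \<in> ball 0 1 \<Longrightarrow> spiral_map lam \<alpha> z = z * exp (H z)"
proof -
  obtain P where P: "\<And>z. z \<in> ball 0 1 \<Longrightarrow> (P has_field_derivative integrand z) (at z)"
    using holomorphic_convex_primitive'[OF convex_ball open_ball integrand_holomorphic]
    by (metis at_within_open open_ball)
  obtain K where K: "\<And>z. z \<in> ball 0 1 \<Longrightarrow> norm (integrand z) \<le> K * norm (z - 1) powr - \<alpha>"
    using norm_integrand_le by blast
  obtain E where E: "continuous_on (closure (ball (0::complex) 1)) E" "\<And>z. z \<in> ball 0 1 \<Longrightarrow> E z = P z"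
  proof (rule continuous_extension_of_derivative_bound[OF alpha convex_ball _ P K])
    show "(1::complex) \<notin> ball 0 1" by simp
  qed auto
  define H where "H z = E z - E 1" for z
  have contH: "continuous_on (cball 0 1) H"
    unfolding H_def using E(1) by (intro continuous_intros) simp
  have derH: "(H has_field_derivative integrand z) (at z)" if z: "z \<in> ball 0 1" for z
  proof -
    have "((\<lambda>z. P z - E 1) has_field_derivative integrand z) (at z)"
      using P[OF z] by (auto intro!: derivative_eq_intros)
    then show ?thesis
      by (rule has_field_derivative_transform_within_open[OF _ open_ball z]) (simp add: H_def E(2))
  qed
  have "contour_integral (linepath 1 z) (\<lambda>\<zeta>. (spiral_power lam \<alpha> \<zeta> - 1) / \<zeta>) = H z" if z: "z \<in> ball 0 1" for z
  proof -
    have cb: "linepath 1 z t \<in> cball 0 1" if "t \<in> {0..1}" for t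
      using closed_segment_subset[of 1 "cball 0 1" z] linepath_in_path[OF that, of 1 z] z by auto
    have inball: "linepath 1 z t \<in> ball 0 1" if "t \<in> {0<..<1}" for t
    proof -
      have "norm (linepath 1 z t) \<le> norm ((1 - t) *\<^sub>R (1::complex)) + norm (t *\<^sub>R z)"
        unfolding linepath_def by (rule norm_triangle_ineq)
      also have "\<dots> = (1 - t) + t * norm z" using that by (simp del: scaleR_conv_of_real)
      also have "\<dots> < 1" using that z by (simp add: algebra_simps)
      finally show ?thesis by simp
    qed
    have "((\<lambda>t. integrand (linepath 1 z t) * (z - 1)) has_integral H (linepath 1 z 1) - H (linepath 1 z 0)) {0..1}"
    proof (rule fundamental_theorem_of_calculus_interior)
      show "continuous_on {0..1} (\<lambda>t. H (linepath 1 z t))"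
        using cb by (intro continuous_on_compose2[OF contH] continuous_on_linepath) auto
      fix t :: real assume t: "t \<in> {0<..<1}"
      from field_vector_diff_chain_at[OF has_vector_derivative_linepath_within[of 1 z t UNIV, simplified] derH[OF inball[OF t]]]
      show "((\<lambda>t. H (linepath 1 z t)) has_vector_derivative integrand (linepath 1 z t) * (z - 1)) (at t)"
        by (simp add: o_def mult.commute)
    qed auto
    then have "((\<lambda>t. (spiral_power lam \<alpha> (linepath 1 z t) - 1) / linepath 1 z t * (z - 1)) has_integral
        H (linepath 1 z 1) - H (linepath 1 z 0)) {0..1}"
    proof (rule has_integral_spike_finite[rotated 2])
      show "finite (linepath 1 z -` {0} \<inter> {0..1})"
        using z by (intro finite_vimage_IntI inj_on_linepath) auto
    qed (auto simp: integrand_def)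
    then have "((\<lambda>\<zeta>. (spiral_power lam \<alpha> \<zeta> - 1) / \<zeta>) has_contour_integral H z) (linepath 1 z)"
      by (simp add: has_contour_integral_linepath H_def linepath_0' linepath_1')
    then show ?thesis by (rule contour_integral_unique)
  qed
  then have "\<And>z. z \<in> ball 0 1 \<Longrightarrow> spiral_map lam \<alpha> z = z * exp (H z)"
    by (simp add: spiral_map_def)
  moreover have "H 1 = 0" by (simp add: H_def)
  ultimately show ?thesis using that[OF contH _ derH] by blast
qed

end

section \<open>Spiral coordinates\<close>

text \<open>The coordinate \<open>\<theta>\<close> of \<open>exp w\<close> with respect to logarithmic spirals, on the level of the
logarithm: \<open>w = (1 + \<i> * tan lam) * Re w + \<i> * spiral_angle lam w\<close>. It is constant along the
spirals, and \<open>Re w\<close> is the other coordinate.\<close>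

definition spiral_angle :: "real \<Rightarrow> complex \<Rightarrow> real" where
  "spiral_angle lam w = Im w - tan lam * Re w"

text \<open>The boundary of the spirallike domain in these coordinates: apart from \<open>0\<close>, the domain is
\<open>Re w < spiral_profile lam \<alpha> (spiral_angle lam w)\<close>.\<close>

definition spiral_profile :: "real \<Rightarrow> real \<Rightarrow> real \<Rightarrow> real" where
  "spiral_profile lam \<alpha> \<theta> = max (spiral_B lam \<alpha> * \<theta>) (- spiral_A lam \<alpha> * (2 * pi - \<theta>))"

context spiral_parameters begin

text \<open>The three functionals to which the sector condition applies, with \<open>\<delta> = 0\<close>,
\<open>\<delta> = pi / 2 - \<beta>\<close> and \<open>\<delta> = - (pi / 2 - \<beta>)\<close>. The last two vanish on the directions of the two
boundary spirals.\<close>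

lemma spiral_angle_functional:
  "Re (- \<i> * cis (- lam) * w) = cos lam * spiral_angle lam w"
  using cos_pos by (simp add: spiral_angle_def tan_def field_simps)

lemma spiral_B_functional:
  "cos lam * Re (- \<i> * cis (pi / 2 - \<beta> - lam) * w) = cos \<beta> * (Re w - spiral_B lam \<alpha> * spiral_angle lam w)"
proof -
  have c: "cis (pi / 2 - \<beta> - lam) = \<i> * cis (- (\<beta> + lam))"
  proof -
    have "pi / 2 - \<beta> - lam = pi / 2 + - (\<beta> + lam)" by simp
    then show ?thesis by (simp only: cis_mult[symmetric] cis_pi_half)
  qed
  have "cos \<beta> * (Re w - spiral_B lam \<alpha> * spiral_angle lam w) =
     cos \<beta> * Re w + (sin \<beta> * cos lam + sin lam * cos \<beta>) * (cos lam * Im w - sin lam * Re w)"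
    unfolding spiral_B_def spiral_angle_def \<beta>_def[symmetric] tan_def
    using cos_pos by (simp add: field_simps power2_eq_square)
  also have "\<dots> = cos lam * (cos (\<beta> + lam) * Re w + sin (\<beta> + lam) * Im w)
     + cos \<beta> * Re w * (1 - (cos lam)\<^sup>2 - (sin lam)\<^sup>2)"
    unfolding cos_add sin_add by algebra
  also have "1 - (cos lam)\<^sup>2 - (sin lam)\<^sup>2 = 0" by (simp add: sin_squared_eq)
  finally show ?thesis unfolding c by (simp del: minus_add_distrib)
qed

lemma spiral_A_functional:
  "cos lam * Re (- \<i> * cis (- (pi / 2 - \<beta>) - lam) * w) = cos \<beta> * (spiral_A lam \<alpha> * spiral_angle lam w - Re w)"
proof -
  have c: "cis (- (pi / 2 - \<beta>) - lam) = - \<i> * cis (\<beta> - lam)"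
  proof -
    have "- (pi / 2 - \<beta>) - lam = - (pi / 2) + (\<beta> - lam)" by simp
    then show ?thesis by (simp only: cis_mult[symmetric] cis_minus_pi_half)
  qed
  have "cos \<beta> * (spiral_A lam \<alpha> * spiral_angle lam w - Re w) =
     (sin \<beta> * cos lam - sin lam * cos \<beta>) * (cos lam * Im w - sin lam * Re w) - cos \<beta> * Re w"
    unfolding spiral_A_def spiral_angle_def \<beta>_def[symmetric] tan_def
    using cos_pos by (simp add: field_simps power2_eq_square)
  also have "\<dots> = cos lam * (sin (\<beta> - lam) * Im w - cos (\<beta> - lam) * Re w)
     - cos \<beta> * Re w * (1 - (cos lam)\<^sup>2 - (sin lam)\<^sup>2)"
    unfolding cos_diff sin_diff by algebra
  also have "1 - (cos lam)\<^sup>2 - (sin lam)\<^sup>2 = 0" by (simp add: sin_squared_eq)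
  finally show ?thesis unfolding c by simp
qed

lemma spiral_A_pos: "0 < spiral_A lam \<alpha>" and spiral_B_neg: "spiral_B lam \<alpha> < 0"
proof -
  have "tan lam < tan \<beta>" by (rule tan_monotone) (use beta in auto)
  moreover have "tan (- \<beta>) < tan lam" by (rule tan_monotone) (use beta in auto)
  ultimately show "0 < spiral_A lam \<alpha>" "spiral_B lam \<alpha> < 0"
    using cos_pos unfolding spiral_A_def spiral_B_def \<beta>_def[symmetric]
    by (auto simp: mult_neg_pos)
qed

lemma spiral_profile_ends:
  "spiral_profile lam \<alpha> 0 = 0" "spiral_profile lam \<alpha> (2 * pi) = 0"
  using spiral_A_pos spiral_B_neg
  by (auto simp: spiral_profile_def max_def mult_le_0_iff zero_le_mult_iff not_le)

text \<open>The spiral coordinates of a nonzero point are unique, except that the angles \<open>0\<close> and \<open>2 * pi\<close>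
are identified; the profile has the same value \<open>0\<close> at both.\<close>

lemma exp_spiral_eqD:
  assumes eq: "exp w = exp w'"
    and w: "0 \<le> spiral_angle lam w" "spiral_angle lam w \<le> 2 * pi"
    and w': "0 \<le> spiral_angle lam w'" "spiral_angle lam w' \<le> 2 * pi"
  shows "Re w = Re w'"
    and "spiral_profile lam \<alpha> (spiral_angle lam w) = spiral_profile lam \<alpha> (spiral_angle lam w')"
proof -
  obtain n :: int where n: "w = w' + (of_int (2 * n) * pi) * \<i>"
    using eq unfolding exp_eq by blast
  then show Re: "Re w = Re w'" by simp
  have ang: "spiral_angle lam w = spiral_angle lam w' + 2 * pi * of_int n"
    using n by (simp add: spiral_angle_def)
  have "2 * pi * of_int n \<le> 2 * pi * 1" "2 * pi * (- 1) \<le> 2 * pi * of_int n"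
    using ang w w' by linarith+
  then have "real_of_int n \<le> 1" "- 1 \<le> real_of_int n"
    by (simp_all only: mult_le_cancel_left_pos[of "2 * pi"] pi_gt_zero zero_less_mult_iff zero_less_numeral simp_thms)
  then consider "n = 0" | "n = 1" | "n = - 1" by linarith
  then show "spiral_profile lam \<alpha> (spiral_angle lam w) = spiral_profile lam \<alpha> (spiral_angle lam w')"
  proof cases
    case 2
    then have "spiral_angle lam w = 2 * pi" "spiral_angle lam w' = 0" using ang w w' by auto
    then show ?thesis by (simp add: spiral_profile_ends)
  next
    case 3
    then have "spiral_angle lam w = 0" "spiral_angle lam w' = 2 * pi" using ang w w' by auto
    then show ?thesis by (simp add: spiral_profile_ends)
  qed (use ang in simp)
qed

lemma exp_spiral_exists:
  assumes "z \<noteq> 0"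
  obtains w where "z = exp w" "0 \<le> spiral_angle lam w" "spiral_angle lam w < 2 * pi"
proof -
  define n where "n = \<lfloor>spiral_angle lam (Ln z) / (2 * pi)\<rfloor>"
  define w where "w = Ln z + (of_int (2 * - n) * pi) * \<i>"
  have "exp w = exp (Ln z)" unfolding exp_eq w_def by blast
  then have "z = exp w" using assms by simp
  moreover have ang: "spiral_angle lam w = spiral_angle lam (Ln z) - of_int n * (2 * pi)"
    by (simp add: spiral_angle_def w_def)
  moreover have "of_int n \<le> spiral_angle lam (Ln z) / (2 * pi)"
    "spiral_angle lam (Ln z) / (2 * pi) < of_int n + 1"
    unfolding n_def by linarith+
  then have "0 \<le> spiral_angle lam (Ln z) - of_int n * (2 * pi)"
    "spiral_angle lam (Ln z) - of_int n * (2 * pi) < 2 * pi"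
    by (simp_all add: field_simps)
  ultimately show ?thesis using that by simp
qed

lemma spirallike_domain_eq:
  "spirallike_domain lam \<alpha> = insert 0 (exp ` {w. 0 \<le> spiral_angle lam w \<and> spiral_angle lam w < 2 * pi \<and>
     Re w < spiral_profile lam \<alpha> (spiral_angle lam w)})" (is "_ = insert 0 (exp ` ?W)")
proof -
  have max: "max (exp (spiral_B lam \<alpha> * \<theta>)) (exp (- spiral_A lam \<alpha> * (2 * pi - \<theta>))) = exp (spiral_profile lam \<alpha> \<theta>)" for \<theta>
    by (simp add: spiral_profile_def max_def)
  have W: "spiral_polar lam r \<theta> \<in> exp ` ?W"
    if "0 \<le> \<theta>" "\<theta> < 2 * pi" "0 < r" "r < exp (spiral_profile lam \<alpha> \<theta>)" for r \<theta>
  proof -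
    define w where "w = (1 + \<i> * of_real (tan lam)) * of_real (ln r) + \<i> * of_real \<theta>"
    have "ln r < spiral_profile lam \<alpha> \<theta>" using that(3,4) by (metis ln_less_cancel_iff exp_gt_zero ln_exp)
    moreover have "spiral_angle lam w = \<theta>" "Re w = ln r"
      by (simp_all add: w_def spiral_angle_def)
    ultimately have "w \<in> ?W" using that by simp
    moreover have "spiral_polar lam r \<theta> = exp w" using that by (simp add: spiral_polar_def w_def)
    ultimately show ?thesis by blast
  qed
  have polar: "exp w = spiral_polar lam (exp (Re w)) (spiral_angle lam w)" for w
  proof -
    have "(1 + \<i> * of_real (tan lam)) * of_real (ln (exp (Re w))) + \<i> * of_real (spiral_angle lam w) = w"
      by (simp add: complex_eq_iff spiral_angle_def)
    then show ?thesis unfolding spiral_polar_def by (simp only: if_False exp_not_eq_zero)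
  qed
  show ?thesis
  proof (intro equalityI subsetI)
    fix z assume "z \<in> spirallike_domain lam \<alpha>"
    then obtain r \<theta> where z: "z = spiral_polar lam r \<theta>" "0 \<le> \<theta>" "\<theta> < 2 * pi" "0 \<le> r"
       "r < exp (spiral_profile lam \<alpha> \<theta>)"
      unfolding spirallike_domain_def max by blast
    show "z \<in> insert 0 (exp ` ?W)"
    proof (cases "r = 0")
      case True
      then show ?thesis using z by (simp add: spiral_polar_def)
    next
      case False
      then show ?thesis using W[of \<theta> r] z by simp
    qed
  next
    fix z assume "z \<in> insert 0 (exp ` ?W)"
    then consider "z = 0" | w where "w \<in> ?W" "z = exp w" by blast
    then show "z \<in> spirallike_domain lam \<alpha>"
    proof cases
      case 1
      then have "z = spiral_polar lam 0 0" by (simp add: spiral_polar_def)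
      then show ?thesis unfolding spirallike_domain_def max by force
    next
      case 2
      then show ?thesis unfolding spirallike_domain_def max using polar[of w] by force
    qed
  qed
qed

lemma spiral_shift:
  "spiral_angle lam (w + of_real s * (1 + \<i> * of_real (tan lam))) = spiral_angle lam w"
  "Re (w + of_real s * (1 + \<i> * of_real (tan lam))) = Re w + s"
  by (simp_all add: spiral_angle_def algebra_simps)

lemma spiral_exterior_notin:
  assumes "0 \<le> spiral_angle lam w" "spiral_angle lam w \<le> 2 * pi"
    and "spiral_profile lam \<alpha> (spiral_angle lam w) \<le> Re w"
  shows "exp w \<notin> spirallike_domain lam \<alpha>"
  using exp_spiral_eqD[of w] assms unfolding spirallike_domain_eq by fastforce

text \<open>The domain is the union of the spirals that run from its points into \<open>0\<close>.\<close>

lemma connected_spirallike_domain: "connected (spirallike_domain lam \<alpha>)"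
proof -
  define v where "v = 1 + \<i> * complex_of_real (tan lam)"
  define W where "W = {w. 0 \<le> spiral_angle lam w \<and> spiral_angle lam w < 2 * pi \<and>
     Re w < spiral_profile lam \<alpha> (spiral_angle lam w)}"
  define R where "R w = (\<lambda>s. exp (w + of_real s * v)) ` {..0::real}" for w
  have conn: "connected (insert 0 (R w))" for w
  proof (rule connected_intermediate_closure)
    show "connected (R w)"
      unfolding R_def by (intro connected_continuous_image continuous_intros) auto
    have "0 \<in> closure (R w)"
      unfolding closure_approachable
    proof (intro allI impI)
      fix e :: real assume e: "e > 0"
      define s where "s = min 0 (ln e - Re w - 1)"
      have "norm (exp (w + of_real s * v)) = exp (Re w + s)"
        by (simp add: v_def)
      also have "\<dots> < exp (ln e)" by (subst exp_less_cancel_iff) (auto simp: s_def)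
      finally have "dist (exp (w + of_real s * v)) 0 < e" using e by simp
      moreover have "exp (w + of_real s * v) \<in> R w" by (auto simp: R_def s_def)
      ultimately show "\<exists>y\<in>R w. dist y 0 < e" by blast
    qed
    then show "insert 0 (R w) \<subseteq> closure (R w)" using closure_subset by auto
  qed auto
  have "w + of_real s * v \<in> W" if "w \<in> W" "s \<le> 0" for w s
    using that spiral_shift[of w s] by (simp add: W_def v_def)
  then have "R w \<subseteq> exp ` W" if "w \<in> W" for w using that by (auto simp: R_def)
  moreover have "exp w \<in> R w" for w by (force simp: R_def)
  ultimately have "insert 0 (exp ` W) = (\<Union>w\<in>W. insert 0 (R w)) \<union> {0}" by blast
  moreover have "connected ((\<Union>w\<in>W. insert 0 (R w)) \<union> {0})"
  proof -
    have "(\<Union>w\<in>W. insert 0 (R w)) \<union> {0} = \<Union> (insert {0} ((\<lambda>w. insert 0 (R w)) ` W))" by blast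
    also have "connected \<dots>" using conn by (intro connected_Union) auto
    finally show ?thesis .
  qed
  ultimately show ?thesis unfolding spirallike_domain_eq W_def[symmetric] by simp
qed

end

section \<open>The boundary curve\<close>

text \<open>If \<open>h\<close> is the derivative of \<open>H\<close>, then \<open>\<i> * t + H (r * cis t)\<close> has the
\<open>t\<close>-derivative \<open>\<i> * (1 + z * h z)\<close> at \<open>z = r * cis t\<close>. A lower bound for a real-linear functional
of this derivative on circles of radius \<open>r < 1\<close> gives an increment bound on the unit circle; no
derivative at the boundary is needed.\<close>

lemma Re_increment_on_circle_ge:
  fixes H :: "complex \<Rightarrow> complex"
  assumes contH: "continuous_on (cball 0 1) H"
    and H: "\<And>z. z \<in> ball 0 1 \<Longrightarrow> (H has_field_derivative h z) (at z)"
    and ab: "a \<le> b" and s: "s < 1"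
    and bd: "\<And>r t. s < r \<Longrightarrow> 0 < r \<Longrightarrow> r < 1 \<Longrightarrow> a \<le> t \<Longrightarrow> t \<le> b \<Longrightarrow>
       Re (\<kappa> * (\<i> * (1 + of_real r * cis t * h (of_real r * cis t)))) \<ge> - e"
  shows "Re (\<kappa> * (\<i> * of_real b + H (cis b))) - Re (\<kappa> * (\<i> * of_real a + H (cis a))) \<ge> - e * (b - a)"
proof -
  define f where "f = (\<lambda>r t. Re (\<kappa> * (\<i> * of_real t + H (of_real r * cis t))))"
  have int: "f r b - f r a \<ge> - e * (b - a)" if r: "s < r" "0 < r" "r < 1" for r
  proof -
    have "f r a + e * a \<le> f r b + e * b"
    proof (rule DERIV_nonneg_imp_nondecreasing[OF ab])
      fix t assume t: "a \<le> t" "t \<le> b"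
      define \<zeta> where "\<zeta> = of_real r * cis t"
      have c: "((\<lambda>t. of_real r * cis t) has_vector_derivative of_real r * (\<i> * cis t)) (at t)"
      proof -
        have "((\<lambda>t. Complex (cos t) (sin t)) has_vector_derivative Complex (- sin t) (cos t)) (at t)"
          unfolding has_vector_derivative_complex_iff by (auto intro!: derivative_eq_intros)
        also have "(\<lambda>t. Complex (cos t) (sin t)) = cis" by (simp add: cis.code fun_eq_iff)
        also have "Complex (- sin t) (cos t) = \<i> * cis t" by (simp add: complex_eq_iff)
        finally show ?thesis by (intro derivative_intros)
      qed
      have "\<zeta> \<in> ball 0 1" using r by (simp add: \<zeta>_def norm_mult)
      from field_vector_diff_chain_at[OF c H[OF this[unfolded \<zeta>_def]]]
      have "((\<lambda>t. H (of_real r * cis t)) has_vector_derivative of_real r * (\<i> * cis t) * h \<zeta>) (at t)"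
        by (simp add: o_def \<zeta>_def)
      then have "((\<lambda>t. \<kappa> * (\<i> * of_real t + H (of_real r * cis t))) has_vector_derivative
          \<kappa> * (\<i> * 1 + of_real r * (\<i> * cis t) * h \<zeta>)) (at t)"
        by (intro derivative_intros has_vector_derivative_real_field) auto
      then have "(f r has_real_derivative Re (\<kappa> * (\<i> * 1 + of_real r * (\<i> * cis t) * h \<zeta>))) (at t)"
        unfolding f_def has_real_derivative_iff_has_vector_derivative
        by (rule bounded_linear.has_vector_derivative[OF bounded_linear_Re])
      then have "((\<lambda>t. f r t + e * t) has_real_derivative Re (\<kappa> * (\<i> * 1 + of_real r * (\<i> * cis t) * h \<zeta>)) + e) (at t)"
        by (auto intro!: derivative_eq_intros)
      moreover have "Re (\<kappa> * (\<i> * 1 + of_real r * (\<i> * cis t) * h \<zeta>)) + e \<ge> 0"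
        using bd[OF r t] by (simp add: \<zeta>_def algebra_simps)
      ultimately show "\<exists>y. ((\<lambda>t. f r t + e * t) has_real_derivative y) (at t) \<and> 0 \<le> y" by blast
    qed
    then show ?thesis by (simp add: algebra_simps)
  qed
  have lim: "((\<lambda>r. f r t) \<longlongrightarrow> f 1 t) (at_left 1)" for t
  proof -
    have "((\<lambda>r. H (of_real r * cis t)) \<longlongrightarrow> H (of_real 1 * cis t)) (at_left 1)"
    proof (rule continuous_on_tendsto_compose[OF contH])
      show "((\<lambda>r. complex_of_real r * cis t) \<longlongrightarrow> of_real 1 * cis t) (at_left 1)"
        by (intro tendsto_intros)
      show "\<forall>\<^sub>F r in at_left 1. complex_of_real r * cis t \<in> cball 0 1"
        using eventually_at_left_real[of 0 1] by (auto elim!: eventually_mono simp: norm_mult)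
    qed (auto simp: norm_mult)
    then show ?thesis unfolding f_def by (intro tendsto_intros)
  qed
  have "f 1 b - f 1 a \<ge> - e * (b - a)"
  proof (rule tendsto_lowerbound)
    show "((\<lambda>r. f r b - f r a) \<longlongrightarrow> f 1 b - f 1 a) (at_left 1)"
      by (intro tendsto_diff lim)
    have "max s 0 < 1" using s by simp
    from eventually_at_left_real[OF this]
    show "\<forall>\<^sub>F r in at_left 1. - e * (b - a) \<le> f r b - f r a"
      by eventually_elim (use int in auto)
  qed auto
  then show ?thesis by (simp add: f_def)
qed

text \<open>\<open>H\<close> stands for the continuous logarithm obtained above, normalised by \<open>H 1 = 0\<close>.\<close>

locale spiral_logarithm = spiral_parameters +
  fixes H :: "complex \<Rightarrow> complex"
  assumes contH: "continuous_on (cball 0 1) H" and H1: "H 1 = 0"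
    and derH: "\<And>z. z \<in> ball 0 1 \<Longrightarrow> (H has_field_derivative integrand z) (at z)"
begin

text \<open>A continuous logarithm of the boundary curve \<open>t \<mapsto> cis t * exp (H (cis t))\<close>.\<close>

definition log_curve :: "real \<Rightarrow> complex" where
  "log_curve t = \<i> * of_real t + H (cis t)"

lemma exp_log_curve: "exp (log_curve t) = cis t * exp (H (cis t))"
  by (simp add: log_curve_def exp_add cis_conv_exp)

lemma continuous_on_log_curve: "continuous_on S log_curve"
  unfolding log_curve_def
  by (intro continuous_intros continuous_on_compose2[OF contH]) auto

lemma log_curve_0: "log_curve 0 = 0" and log_curve_2pi: "log_curve (2 * pi) = 2 * pi * \<i>"
  by (simp_all add: log_curve_def H1)

lemma log_curve_mono:
  assumes "a \<le> b" "\<bar>\<delta>\<bar> \<le> pi / 2 - \<beta>"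
  shows "Re (- \<i> * cis (\<delta> - lam) * log_curve a) \<le> Re (- \<i> * cis (\<delta> - lam) * log_curve b)"
proof -
  have "- 0 * (b - a) \<le> Re ((- \<i> * cis (\<delta> - lam)) * (\<i> * of_real b + H (cis b))) -
      Re ((- \<i> * cis (\<delta> - lam)) * (\<i> * of_real a + H (cis a)))"
  proof (rule Re_increment_on_circle_ge[OF contH derH assms(1), where s = 0])
    fix r t :: real assume r: "0 < r" "r < 1"
    have "norm (of_real r * cis t) < 1" using r by (simp add: norm_mult)
    from spiral_power_sector[OF this assms(2)]
    show "- 0 \<le> Re (- \<i> * cis (\<delta> - lam) * (\<i> * (1 + of_real r * cis t * integrand (of_real r * cis t))))"
      unfolding times_integrand by (simp add: mult.assoc[symmetric])
  qed auto
  then show ?thesis by (simp add: log_curve_def)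
qed

text \<open>On a closed part of one of the two open boundary arcs the derivative of the functional tends to
\<open>0\<close> uniformly as the radius tends to \<open>1\<close>, by uniform continuity of the power near that part. So
the monotone functional does not increase.\<close>

lemma log_curve_const:
  assumes ab: "0 < a" "a \<le> b" "b < 2 * pi" and \<sigma>: "\<sigma> \<noteq> 0"
    and cos: "\<And>t. t \<in> {a..b} \<Longrightarrow> sgn (cos (\<mu> + t / 2)) = \<sigma>"
  defines "\<kappa> \<equiv> - \<i> * cis (\<sigma> * (pi / 2 - \<beta>) - lam)"
  shows "Re (\<kappa> * log_curve b) = Re (\<kappa> * log_curve a)"
proof (rule antisym)
  have "\<bar>\<sigma>\<bar> = 1" using cos[of a] ab(2) \<sigma> by (auto simp: sgn_if split: if_splits)
  then have "\<bar>\<sigma> * (pi / 2 - \<beta>)\<bar> \<le> pi / 2 - \<beta>" using beta by (simp add: abs_mult)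
  from log_curve_mono[OF ab(2) this] show "Re (\<kappa> * log_curve a) \<le> Re (\<kappa> * log_curve b)"
    by (simp add: \<kappa>_def)
  define f where "f = (\<lambda>(r, t). Re (- \<kappa> * (\<i> * spiral_power lam \<alpha> (of_real r * cis t))))"
  define S where "S = {1/2..1::real} \<times> {a..b}"
  have \<kappa>: "- \<kappa> * \<i> = - cis (\<sigma> * (pi / 2 - \<beta>) - lam)" by (simp add: \<kappa>_def complex_eq_iff)
  have cos0: "cos (\<mu> + t / 2) \<noteq> 0" if "t \<in> {a..b}" for t using cos[OF that] \<sigma> by auto
  have f1: "f (1, t) = 0" if "t \<in> {a..b}" for t
    using spiral_power_boundary(1)[of t] cos0[OF that] that ab cos[OF that]
    by (simp add: f_def mult.assoc[symmetric] \<kappa>[simplified])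
  have "continuous_on S (\<lambda>x. spiral_power lam \<alpha> (of_real (fst x) * cis (snd x)))"
  proof (rule continuous_on_compose2[OF continuous_on_spiral_power])
    show "continuous_on S (\<lambda>x. complex_of_real (fst x) * cis (snd x))"
      by (intro continuous_intros)
    show "(\<lambda>x. complex_of_real (fst x) * cis (snd x)) ` S
        \<subseteq> {z \<in> cball 0 1. z \<noteq> 1 \<and> half_plane_base \<mu> z \<noteq> 0}"
    proof (rule image_subsetI)
      fix x assume "x \<in> S"
      then obtain r t where x: "x = (r, t)" "1/2 \<le> r" "r \<le> 1" "a \<le> t" "t \<le> b" by (auto simp: S_def)
      have n: "norm (complex_of_real r * cis t) = r" using x by (simp add: norm_mult)
      show "complex_of_real (fst x) * cis (snd x) \<in> {z \<in> cball 0 1. z \<noteq> 1 \<and> half_plane_base \<mu> z \<noteq> 0}"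
      proof (cases "r = 1")
        case True
        have nz: "half_plane_base \<mu> (cis t) \<noteq> 0"
          using spiral_power_boundary(2)[of t] cos0[of t] x ab by auto
        moreover have "cis t \<noteq> 1" using nz by (auto simp: half_plane_base_def)
        ultimately show ?thesis using x True by auto
      next
        case False
        then have "norm (complex_of_real r * cis t) < 1" using n x by simp
        then show ?thesis using half_plane_base_nonzero x by auto
      qed
    qed
  qed
  then have "continuous_on S f"
    unfolding f_def case_prod_unfold by (intro continuous_intros)
  then have uc: "uniformly_continuous_on S f"
    by (rule compact_uniformly_continuous) (auto simp: S_def intro: compact_Times)
  have ge: "Re (- \<kappa> * log_curve b) - Re (- \<kappa> * log_curve a) \<ge> - e * (b - a)" if e: "e > 0" for e
  proof -
    obtain d where d: "d > 0" "\<And>x x'. x \<in> S \<Longrightarrow> x' \<in> S \<Longrightarrow> dist x' x < d \<Longrightarrow> dist (f x') (f x) < e"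
      using uc e unfolding uniformly_continuous_on_def by metis
    show ?thesis unfolding log_curve_def
    proof (rule Re_increment_on_circle_ge[OF contH derH ab(2), where s = "max (1/2) (1 - d)"])
      fix r t assume r: "max (1 / 2) (1 - d) < r" "r < 1" and t: "a \<le> t" "t \<le> b"
      have "dist (f (r, t)) (f (1, t)) < e"
        using r t by (intro d(2)) (auto simp: S_def dist_Pair_Pair dist_real_def)
      then have "\<bar>f (r, t)\<bar> < e" using f1[of t] t by (simp add: dist_real_def)
      then show "- e \<le> Re (- \<kappa> * (\<i> * (1 + of_real r * cis t * integrand (of_real r * cis t))))"
        unfolding times_integrand by (simp add: f_def)
    qed (use d in auto)
  qed
  have le: "Re (\<kappa> * log_curve b) - Re (\<kappa> * log_curve a) \<le> e * (b - a)" if "e > 0" for e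
    using ge[OF that] by (simp add: algebra_simps)
  have "((\<lambda>e. e * (b - a)) \<longlongrightarrow> 0 * (b - a)) (at_right 0)" by (intro tendsto_intros)
  then have "Re (\<kappa> * log_curve b) - Re (\<kappa> * log_curve a) \<le> 0 * (b - a)"
  proof (rule tendsto_lowerbound)
    show "\<forall>\<^sub>F e in at_right 0. Re (\<kappa> * log_curve b) - Re (\<kappa> * log_curve a) \<le> e * (b - a)"
      by (rule eventually_mono[OF eventually_at_right_less[of 0]]) (rule le)
  qed auto
  then show "Re (\<kappa> * log_curve b) \<le> Re (\<kappa> * log_curve a)" by simp
qed

lemma log_curve_const_closed:
  assumes ab: "0 \<le> a" "a < b" "b \<le> 2 * pi" and \<sigma>: "\<sigma> \<noteq> 0"
    and cos: "\<And>t. t \<in> {a<..<b} \<Longrightarrow> sgn (cos (\<mu> + t / 2)) = \<sigma>"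
    and t: "t \<in> {a..b}" "t' \<in> {a..b}"
  defines "\<kappa> \<equiv> - \<i> * cis (\<sigma> * (pi / 2 - \<beta>) - lam)"
  shows "Re (\<kappa> * log_curve t) = Re (\<kappa> * log_curve t')"
proof -
  define m where "m = (a + b) / 2"
  have "Re (\<kappa> * log_curve x) = Re (\<kappa> * log_curve m)" if x: "x \<in> {a..b}" for x
  proof (rule continuous_constant_on_closure[where S = "{a<..<b}" and f = "\<lambda>x. Re (\<kappa> * log_curve x)"])
    show "continuous_on (closure {a<..<b}) (\<lambda>x. Re (\<kappa> * log_curve x))"
      by (intro continuous_intros continuous_on_log_curve)
    show "x \<in> closure {a<..<b}" using x ab by simp
    fix y assume y: "y \<in> {a<..<b}"
    have m: "a < m" "m < b" using ab by (auto simp: m_def)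
    show "Re (\<kappa> * log_curve y) = Re (\<kappa> * log_curve m)"
    proof (cases "y \<le> m")
      case True
      then show ?thesis unfolding \<kappa>_def using y m ab \<sigma>
        by (intro log_curve_const[symmetric] cos) auto
    next
      case False
      then show ?thesis unfolding \<kappa>_def using y m ab \<sigma>
        by (intro log_curve_const cos) auto
    qed
  qed
  from this[OF t(1)] this[OF t(2)] show ?thesis by simp
qed

text \<open>The inequality \<open>\<ge>\<close> follows from monotonicity between the end points, and equality with one of
the two entries of the maximum from constancy on the arcs.\<close>

lemma log_curve_profile:
  assumes t: "t \<in> {0..2 * pi}"
  shows "0 \<le> spiral_angle lam (log_curve t)" "spiral_angle lam (log_curve t) \<le> 2 * pi"
    and "Re (log_curve t) = spiral_profile lam \<alpha> (spiral_angle lam (log_curve t))"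
proof -
  define \<theta> where "\<theta> s = spiral_angle lam (log_curve s)" for s
  define \<rho> where "\<rho> s = Re (log_curve s)" for s
  define A B where "A = spiral_A lam \<alpha>" and "B = spiral_B lam \<alpha>"
  have ends: "\<theta> 0 = 0" "\<theta> (2 * pi) = 2 * pi" "\<rho> 0 = 0" "\<rho> (2 * pi) = 0"
    by (simp_all add: \<theta>_def \<rho>_def spiral_angle_def log_curve_0 log_curve_2pi)
  have mono\<theta>: "\<theta> s \<le> \<theta> s'" if "s \<le> s'" for s s'
    using log_curve_mono[OF that, of 0] beta spiral_angle_functional[of "log_curve s"]
      spiral_angle_functional[of "log_curve s'"] cos_pos by (simp add: \<theta>_def)
  have monoB: "\<rho> s - B * \<theta> s \<le> \<rho> s' - B * \<theta> s'" if "s \<le> s'" for s s'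
  proof -
    have "cos lam * Re (- \<i> * cis (pi / 2 - \<beta> - lam) * log_curve s) \<le> cos lam * Re (- \<i> * cis (pi / 2 - \<beta> - lam) * log_curve s')"
      using cos_pos beta by (intro mult_left_mono log_curve_mono that) auto
    then show ?thesis
      unfolding spiral_B_functional using cos_pos by (simp add: \<theta>_def \<rho>_def B_def)
  qed
  have monoA: "A * \<theta> s - \<rho> s \<le> A * \<theta> s' - \<rho> s'" if "s \<le> s'" for s s'
  proof -
    have "cos lam * Re (- \<i> * cis (- (pi / 2 - \<beta>) - lam) * log_curve s) \<le> cos lam * Re (- \<i> * cis (- (pi / 2 - \<beta>) - lam) * log_curve s')"
      using cos_pos beta by (intro mult_left_mono log_curve_mono that) auto
    then show ?thesis
      unfolding spiral_A_functional using cos_pos by (simp add: \<theta>_def \<rho>_def A_def)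
  qed
  have t': "0 \<le> t" "t \<le> 2 * pi" using t by auto
  show "0 \<le> spiral_angle lam (log_curve t)" "spiral_angle lam (log_curve t) \<le> 2 * pi"
    using mono\<theta>[OF t'(1)] mono\<theta>[OF t'(2)] ends by (simp_all add: \<theta>_def)
  have ge: "B * \<theta> t \<le> \<rho> t" "- A * (2 * pi - \<theta> t) \<le> \<rho> t"
    using monoB[OF t'(1)] monoA[OF t'(2)] ends by (simp_all add: algebra_simps)
  \<comment> \<open>the parameter of the zero of the power on the circle, where the two arcs meet\<close>
  define c where "c = pi - 2 * \<mu>"
  have c: "0 < c" "c < 2 * pi" using mu by (auto simp: c_def)
  have "\<rho> t = B * \<theta> t \<or> \<rho> t = - A * (2 * pi - \<theta> t)"
  proof (cases "t \<le> c")
    case True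
    have "Re (- \<i> * cis (1 * (pi / 2 - \<beta>) - lam) * log_curve t) = Re (- \<i> * cis (1 * (pi / 2 - \<beta>) - lam) * log_curve 0)"
    proof (rule log_curve_const_closed[of 0 c])
      fix s assume "s \<in> {0<..<c}"
      then have "0 < cos (\<mu> + s / 2)" using mu by (intro cos_gt_zero_pi) (auto simp: c_def)
      then show "sgn (cos (\<mu> + s / 2)) = 1" by simp
    qed (use c t' True in auto)
    then have "Re (- \<i> * cis (pi / 2 - \<beta> - lam) * log_curve t) = 0"
      by (simp add: log_curve_0)
    then have "\<rho> t - B * \<theta> t = 0"
      using spiral_B_functional[of "log_curve t"] cos_pos by (simp add: \<theta>_def \<rho>_def B_def)
    then show ?thesis by simp
  next
    case False
    have "Re (- \<i> * cis (- 1 * (pi / 2 - \<beta>) - lam) * log_curve t) = Re (- \<i> * cis (- 1 * (pi / 2 - \<beta>) - lam) * log_curve (2 * pi))"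
    proof (rule log_curve_const_closed[of c "2 * pi"])
      fix s assume "s \<in> {c<..<2 * pi}"
      then have "0 < cos (\<mu> + s / 2 - pi)" using mu by (intro cos_gt_zero_pi) (auto simp: c_def)
      then show "sgn (cos (\<mu> + s / 2)) = - 1" by simp
    qed (use c t' False in auto)
    then have "Re (- \<i> * cis (- (pi / 2 - \<beta>) - lam) * log_curve t) = Re (- \<i> * cis (- (pi / 2 - \<beta>) - lam) * log_curve (2 * pi))"
      by (simp del: minus_diff_eq)
    then have "A * \<theta> t - \<rho> t = A * \<theta> (2 * pi) - \<rho> (2 * pi)"
      using spiral_A_functional[of "log_curve t"] spiral_A_functional[of "log_curve (2 * pi)"] cos_pos
      by (simp add: \<theta>_def \<rho>_def A_def)
    then show ?thesis using ends by (simp add: algebra_simps)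
  qed
  then show "Re (log_curve t) = spiral_profile lam \<alpha> (spiral_angle lam (log_curve t))"
    using ge unfolding spiral_profile_def A_def B_def \<theta>_def \<rho>_def by linarith
qed

end

section \<open>Bijectivity\<close>

context spiral_logarithm begin

text \<open>The continuous extension of the map to the closed disc.\<close>

definition spiral_ext :: "complex \<Rightarrow> complex" where
  "spiral_ext z = z * exp (H z)"

lemma continuous_on_spiral_ext: "continuous_on (cball 0 1) spiral_ext"
  unfolding spiral_ext_def by (intro continuous_intros contH)

lemma spiral_ext_has_derivative:
  assumes "z \<in> ball 0 1"
  shows "(spiral_ext has_field_derivative exp (H z) * spiral_power lam \<alpha> z) (at z)"
  unfolding spiral_ext_def times_integrand[symmetric]
  by (auto intro!: derivative_eq_intros derH[OF assms] simp: algebra_simps)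

lemma spiral_ext_holomorphic: "spiral_ext holomorphic_on ball 0 1"
  unfolding holomorphic_on_open[OF open_ball] using spiral_ext_has_derivative by blast

lemma spiral_ext_locally_injective:
  assumes z: "z \<in> ball 0 1"
  shows "\<exists>r>0. inj_on spiral_ext (ball z r)"
proof -
  have "deriv spiral_ext z \<noteq> 0"
    using DERIV_imp_deriv[OF spiral_ext_has_derivative[OF z]] spiral_power_nonzero z by simp
  then show ?thesis
    using has_complex_derivative_locally_injective[OF spiral_ext_holomorphic z open_ball] by blast
qed

lemma spiral_ext_open_map:
  assumes V: "open V" "V \<subseteq> ball 0 1"
  shows "open (spiral_ext ` V)"
proof (rule open_mapping_thm[OF spiral_ext_holomorphic open_ball _ V])
  show "\<not> spiral_ext constant_on ball 0 1"
  proof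
    assume "spiral_ext constant_on ball 0 1"
    then have "spiral_ext (1/2) = spiral_ext 0" unfolding constant_on_def by auto
    then show False by (simp add: spiral_ext_def)
  qed
qed auto

lemma spiral_ext_sphere:
  assumes "z \<in> sphere 0 1"
  obtains w where "spiral_ext z = exp w" "0 \<le> spiral_angle lam w" "spiral_angle lam w \<le> 2 * pi"
    "Re w = spiral_profile lam \<alpha> (spiral_angle lam w)"
proof -
  have "z \<noteq> 0" using assms by auto
  then obtain t where t: "0 \<le> t" "t < 2 * pi" "z = cis t"
    using assms complex_unimodular_polar[of z] by (auto simp: cis.ctr)
  then have "spiral_ext z = exp (log_curve t)" by (simp add: exp_log_curve spiral_ext_def)
  moreover have "t \<in> {0..2 * pi}" using t by auto
  ultimately show ?thesis using that log_curve_profile by blast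
qed

lemma sphere_avoids_domain: "spirallike_domain lam \<alpha> \<inter> spiral_ext ` sphere 0 1 = {}"
proof -
  have "spiral_ext z \<notin> spirallike_domain lam \<alpha>" if z: "z \<in> sphere 0 1" for z
  proof -
    obtain w where "spiral_ext z = exp w" "0 \<le> spiral_angle lam w" "spiral_angle lam w \<le> 2 * pi"
       "Re w = spiral_profile lam \<alpha> (spiral_angle lam w)"
      using spiral_ext_sphere[OF z] by blast
    then show ?thesis using spiral_exterior_notin[of w] by simp
  qed
  then show ?thesis by blast
qed

lemma zero_in_domain: "0 \<in> spirallike_domain lam \<alpha>"
  by (simp add: spirallike_domain_eq)

lemma domain_subset_image: "spirallike_domain lam \<alpha> \<subseteq> spiral_ext ` ball 0 1"
proof (rule connected_subset_image_ball[OF continuous_on_spiral_ext _ connected_spirallike_domain sphere_avoids_domain])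
  show "open (spiral_ext ` ball 0 1)" by (rule spiral_ext_open_map) auto
  have "spiral_ext 0 = 0" by (simp add: spiral_ext_def)
  then have "0 \<in> spiral_ext ` ball 0 1" by (metis centre_in_ball imageI zero_less_one)
  then show "spirallike_domain lam \<alpha> \<inter> spiral_ext ` ball 0 1 \<noteq> {}"
    using zero_in_domain by blast
qed

text \<open>Here the spiral through a value outside the domain is followed outwards: it does not meet the
image of the circle again.\<close>

lemma image_subset_domain: "spiral_ext ` ball 0 1 \<subseteq> spirallike_domain lam \<alpha>"
proof (rule ccontr)
  assume "\<not> spiral_ext ` ball 0 1 \<subseteq> spirallike_domain lam \<alpha>"
  then obtain y where y: "y \<in> spiral_ext ` ball 0 1" "y \<notin> spirallike_domain lam \<alpha>" by blast
  then have "y \<noteq> 0" using zero_in_domain by auto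
  then obtain w where w: "y = exp w" "0 \<le> spiral_angle lam w" "spiral_angle lam w < 2 * pi"
    using exp_spiral_exists by blast
  have ge: "spiral_profile lam \<alpha> (spiral_angle lam w) \<le> Re w"
    using y(2) w unfolding spirallike_domain_eq by force
  define v where "v = 1 + \<i> * complex_of_real (tan lam)"
  define \<gamma> where "\<gamma> s = exp (w + of_real s * v)" for s
  have cont: "continuous_on S \<gamma>" for S unfolding \<gamma>_def by (intro continuous_intros)
  have op: "open (spiral_ext ` ball 0 1)" by (rule spiral_ext_open_map) auto
  \<comment> \<open>A small push along the spiral stays in the open image and leaves the boundary curve.\<close>
  obtain e where e: "e > 0" "\<gamma> e \<in> spiral_ext ` ball 0 1"
  proof -
    have "(\<gamma> \<longlongrightarrow> \<gamma> 0) (at_right 0)"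
      using cont[of UNIV] by (auto simp: continuous_on_def intro: tendsto_within_subset)
    then have "\<forall>\<^sub>F s in at_right 0. \<gamma> s \<in> spiral_ext ` ball 0 1"
      by (rule topological_tendstoD[OF _ op]) (use y(1) w(1) in \<open>simp add: \<gamma>_def\<close>)
    then obtain b where "b > 0" "\<And>s. 0 < s \<Longrightarrow> s < b \<Longrightarrow> \<gamma> s \<in> spiral_ext ` ball 0 1"
      unfolding eventually_at_right_field by blast
    then show ?thesis using that[of "b / 2"] by simp
  qed
  have "\<gamma> ` {e..} \<subseteq> spiral_ext ` ball 0 1"
  proof (rule connected_subset_image_ball[OF continuous_on_spiral_ext op])
    show "connected (\<gamma> ` {e..})" by (intro connected_continuous_image cont) auto
    show "\<gamma> ` {e..} \<inter> spiral_ext ` ball 0 1 \<noteq> {}" using e(2) by auto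
    have "\<gamma> s \<noteq> spiral_ext z" if s: "s \<ge> e" and z: "z \<in> sphere 0 1" for s z
    proof
      assume eq: "\<gamma> s = spiral_ext z"
      obtain u where u: "spiral_ext z = exp u" "0 \<le> spiral_angle lam u" "spiral_angle lam u \<le> 2 * pi"
         "Re u = spiral_profile lam \<alpha> (spiral_angle lam u)"
        using spiral_ext_sphere[OF z] by blast
      define w' where "w' = w + of_real s * v"
      have w': "spiral_angle lam w' = spiral_angle lam w" "Re w' = Re w + s"
        using spiral_shift[of w s] by (simp_all add: w'_def v_def)
      have "exp w' = exp u" using eq u(1) by (simp add: w'_def \<gamma>_def)
      from exp_spiral_eqD[OF this] u w w' have "Re w' = spiral_profile lam \<alpha> (spiral_angle lam w)" by simp
      then show False using ge w' s e(1) by simp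
    qed
    then show "\<gamma> ` {e..} \<inter> spiral_ext ` sphere 0 1 = {}" by auto
  qed
  moreover have "bounded (spiral_ext ` cball 0 1)"
    by (intro compact_imp_bounded compact_continuous_image continuous_on_spiral_ext) auto
  then have "bounded (spiral_ext ` ball 0 1)" by (rule bounded_subset) auto
  ultimately have "bounded (\<gamma> ` {e..})" by (rule bounded_subset[rotated])
  then obtain M where M: "M > 0" "\<And>s. s \<ge> e \<Longrightarrow> norm (\<gamma> s) \<le> M" by (auto simp: bounded_pos)
  define s where "s = max e (ln M - Re w + 1)"
  have "M = exp (ln M)" using M(1) by simp
  also have "\<dots> < exp (Re w + s)" by (subst exp_less_cancel_iff) (auto simp: s_def)
  also have "\<dots> = norm (\<gamma> s)" by (simp add: \<gamma>_def v_def)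
  finally show False using M(2)[of s] by (simp add: s_def)
qed

lemma bij_betw_spiral_ext: "bij_betw spiral_ext (ball 0 1) (spirallike_domain lam \<alpha>)"
proof -
  have "inj_on spiral_ext (ball 0 1 \<inter> spiral_ext -` spirallike_domain lam \<alpha>)"
  proof (rule inj_on_preimage_of_connected[OF continuous_on_spiral_ext spiral_ext_open_map
        spiral_ext_locally_injective connected_spirallike_domain sphere_avoids_domain zero_in_domain])
    fix z z' assume "spiral_ext z = 0" "spiral_ext z' = 0"
    then show "z = z'" by (simp add: spiral_ext_def)
  qed
  moreover have "ball 0 1 \<inter> spiral_ext -` spirallike_domain lam \<alpha> = ball 0 1"
    using image_subset_domain by blast
  ultimately show ?thesis
    using domain_subset_image image_subset_domain by (simp add: bij_betw_def subset_antisym)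
qed

end

theorem theorem3p3:
  fixes lam \<alpha> :: real
  assumes "\<bar>lam\<bar> < pi * \<alpha> / 2" and "pi * \<alpha> / 2 < pi / 2"
  shows "maps_conformally_onto (spiral_map lam \<alpha>) (ball 0 1) (spirallike_domain lam \<alpha>) \<and>
         spiral_map lam \<alpha> 0 = 0 \<and>
         (\<exists>G. continuous_on (cball 0 1) G \<and>
              (\<forall>z\<in>ball 0 1. G z = spiral_map lam \<alpha> z) \<and> G 1 = 1)"
proof -
  interpret spiral_parameters lam \<alpha> using assms by unfold_locales
  obtain H where H: "continuous_on (cball 0 1) H" "H 1 = 0"
    "\<And>z. z \<in> ball 0 1 \<Longrightarrow> (H has_field_derivative integrand z) (at z)"
    and map: "\<And>z. z \<in> ball 0 1 \<Longrightarrow> spiral_map lam \<alpha> z = z * exp (H z)"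
    using logarithm_exists by blast
  interpret spiral_logarithm lam \<alpha> H using H by unfold_locales
  have eq: "spiral_ext z = spiral_map lam \<alpha> z" if "z \<in> ball 0 1" for z
    using map[OF that] by (simp add: spiral_ext_def)
  have "spiral_map lam \<alpha> holomorphic_on ball 0 1"
    using spiral_ext_holomorphic eq by (rule holomorphic_transform)
  moreover have "bij_betw (spiral_map lam \<alpha>) (ball 0 1) (spirallike_domain lam \<alpha>)"
    by (rule iffD1[OF bij_betw_cong[OF eq] bij_betw_spiral_ext])
  moreover have "spiral_ext 1 = 1" by (simp add: spiral_ext_def H1)
  moreover have "spiral_map lam \<alpha> 0 = 0" by (simp add: spiral_map_def)
  ultimately show ?thesis
    unfolding maps_conformally_onto_def using continuous_on_spiral_ext eq by blast
qed

end
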